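(* Let $(G,\lambda)$ be a Borel groupoid with Haar system and let $((Y,\nu),(X,\mu),p)$ be a measure preserving ergodic pair of measured $G$-spaces. Denote by $\phi$ the homomorphism $(y,\gamma)\mapsto(p(y),\gamma)$ from $Y\rtimes G$ onto $X\rtimes G$. Then for every representation $L$ of the measured groupoid $(X\rtimes G,[\mu])$, the map $$\phi^*: H^1((X\rtimes G,[\mu]),L)\to H^1((Y\rtimes G,[\nu]),L\circ\phi)$$ induced by $b\mapsto b\circ\phi$ is injective.
   Context: Conventions: Borel spaces are standard, Hilbert spaces are separable. For a groupoid $G$: $G^{(0)}$ is the unit space, $r,s$ the range and source maps, $G^x=r^{-1}(x)$. A Borel groupoid is a groupoid with a Borel structure for which all operations are Borel. A Borel system of measures for a Borel surjection $q:Z\to X$ is a family $(\rho^x)_{x\in X}$ of measures $\rho^x$ on $q^{-1}(x)$ with $x\mapsto\rho^x(f)$ Borel for each non-negative Borel $f$ on $Z$. A Haar system on $G$ is a Borel system of measures $\lambda=(\lambda^x)$ for $r:G\to G^{(0)}$ which is left invariant ($\gamma\lambda^{s(\gamma)}=\lambda^{r(\gamma)}$) and such that some positive Borel $f$ on $G$ satisfies $\lambda^x(f)=1$ for all $x$. A (left) $G$-space is a Borel space $X$ with a Borel surjection $r:X\to G^{(0)}$ and a Borel map $(\gamma,x)\mapsto\gamma x$, defined when $s(\gamma)=r(x)$, satisfying $r(\gamma x)=r(\gamma)$, $r(x)x=x$ and $(\gamma_2\gamma_1)x=\gamma_2(\gamma_1x)$. The semi-direct groupoid is $X\rtimes G=\{(x,\gamma):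 r(x)=r(\gamma)\}$ with unit space $X$, range $x$, source $\gamma^{-1}x$, product $(x,\gamma_1)(\gamma_1^{-1}x,\gamma_2)=(x,\gamma_1\gamma_2)$, Haar system $\delta_x\times\lambda^{r(x)}$. A measure $\mu$ on $X$ is quasi-invariant if $\mu\circ\lambda: f\mapsto\iint f(x,\gamma)\,d\lambda^{r(x)}(\gamma)\,d\mu(x)$ is equivalent to its image under inversion of $X\rtimes G$; $(X\rtimes G,[\mu])$ denotes $X\rtimes G$ with the class of $\mu\circ\lambda$. It (or the $G$-space) is ergodic if every invariant Borel subset of $X$ is $\mu$-null or conull. An inessential reduction is the reduction of the groupoid to a conull Borel subset of its unit space. A pair $((Y,\nu),(X,\mu),p)$ of measured $G$-spaces consists of $G$-spaces $Y,X$ with quasi-invariant measures $\nu,\mu$ and a $G$-equivariant Borel map $p:Y\to X$ such that $\mu$ is equivalent to the image under $p$ of a finite measure equivalent to $\nu$. The pair is ergodic if both $G$-spaces are ergodic. It is measure preserving if $\nu=\int\rho^x\,d\mu(x)$, where $(\rho^x)_{x\in X}$ is a Borel system of probability measures for $p$ that is invariant: $\gamma\rho^x=\rho^{\gamma x}$ whenever $s(\gamma)=r(x)$. A Hilbert bundle is a Borel field of separable Hilbert spaces. A representation of a measured groupoid $\Gamma$ (unit space $Z$) in a Hilbert bundle $\mathcal{H}$ over $Z$ is a Borel map $\gamma\mapsto L(\gamma)$ with $L(\gamma):\mathcal{H}(s(\gamma))\to\mathcal{H}(r(\gamma))$ a Hilbert space isomorphism, multiplicative on some inessential reduction. An $L$-cocycle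 is a Borel map $b$, $b(\gamma)\in\mathcal{H}(r(\gamma))$, with $b(\gamma_1\gamma_2)=b(\gamma_1)+L(\gamma_1)b(\gamma_2)$ on composable pairs of some inessential reduction; it is a coboundary if $b(\gamma)=\xi(r(\gamma))-L(\gamma)\xi(s(\gamma))$ a.e. for some Borel section $\xi$. $H^1(\Gamma,L)$ is the space of $L$-cocycles (modulo a.e. equality) modulo coboundaries. $L\circ\phi$ is the representation of $Y\rtimes G$ in the pull-back bundle $y\mapsto\mathcal{H}(p(y))$. *)

theory Defs
  imports "HOL-Probability.Probability"
begin

section \<open>Borel spaces and measures\<close>

text \<open>
  A Borel space is carried by a value of type \<open>'a measure\<close> of which only \<open>space\<close> and \<open>sets\<close> are used;
  a measure on the Borel space \<open>M\<close> is a value \<open>\<mu>\<close> with \<open>sets \<mu> = sets M\<close>.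
\<close>

definition standard_borel :: "'a measure \<Rightarrow> bool" where
  "standard_borel M \<longleftrightarrow>
     (\<exists>T. completely_metrizable_space T \<and> second_countable T \<and> topspace T = space M \<and>
          sets M = sigma_sets (space M) {U. openin T U})"

definition equivalent_measures :: "'a measure \<Rightarrow> 'a measure \<Rightarrow> bool" where
  "equivalent_measures M N \<longleftrightarrow>
     sets M = sets N \<and> absolutely_continuous M N \<and> absolutely_continuous N M"

definition conull :: "'a measure \<Rightarrow> 'a set \<Rightarrow> bool" where
  "conull \<mu> U \<longleftrightarrow> U \<in> sets \<mu> \<and> space \<mu> - U \<in> null_sets \<mu>"

text \<open>
  A measure on the fibre \<open>q\<^sup>-\<^sup>1(x)\<close> is represented by a measure on \<open>Z\<close> that is
  concentrated on this fibre.
\<close>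

definition borel_system :: "'z measure \<Rightarrow> 'x measure \<Rightarrow> ('z \<Rightarrow> 'x) \<Rightarrow> ('x \<Rightarrow> 'z measure) \<Rightarrow> bool" where
  "borel_system Z X q \<rho> \<longleftrightarrow>
     q \<in> measurable Z X \<and> q ` space Z = space X \<and>
     (\<forall>x\<in>space X. sets (\<rho> x) = sets Z \<and> {z \<in> space Z. q z \<noteq> x} \<in> null_sets (\<rho> x)) \<and>
     (\<forall>f\<in>borel_measurable Z. (\<lambda>x. \<integral>\<^sup>+ z. f z \<partial>(\<rho> x)) \<in> borel_measurable X)"


section \<open>Borel groupoids with Haar system\<close>

text \<open>
  The unit space is kept as a separate Borel space \<open>obj\<close>, embedded into the arrows by \<open>uni\<close>; this
  gives it the Borel structure of the subset \<open>G\<^sup>0\<close>, since \<open>uni\<close> is Borel with Borel left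
  inverse \<open>rng\<close>. The operations are total functions whose values outside their domains are irrelevant.
  An arrow \<open>g\<close> goes from \<open>src g\<close> to \<open>rng g\<close>, and \<open>mlt g h\<close> is meaningful if \<open>src g = rng h\<close>.
\<close>

record ('g, 'u) groupoid =
  arr :: "'g measure"
  obj :: "'u measure"
  rng :: "'g \<Rightarrow> 'u"
  src :: "'g \<Rightarrow> 'u"
  uni :: "'u \<Rightarrow> 'g"
  mlt :: "'g \<Rightarrow> 'g \<Rightarrow> 'g"
  ivs :: "'g \<Rightarrow> 'g"

record ('g, 'u) haar_groupoid = "('g, 'u) groupoid" +
  haar :: "'u \<Rightarrow> 'g measure"

record ('g, 'u) measured_groupoid = "('g, 'u) haar_groupoid" +
  umeas :: "'u measure"

locale groupoid =
  fixes G :: "('g, 'u, 'm) groupoid_scheme"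
  assumes rng_closed: "g \<in> space (arr G) \<Longrightarrow> rng G g \<in> space (obj G)"
    and src_closed: "g \<in> space (arr G) \<Longrightarrow> src G g \<in> space (obj G)"
    and uni_closed: "u \<in> space (obj G) \<Longrightarrow> uni G u \<in> space (arr G)"
    and rng_uni: "u \<in> space (obj G) \<Longrightarrow> rng G (uni G u) = u"
    and src_uni: "u \<in> space (obj G) \<Longrightarrow> src G (uni G u) = u"
    and mlt_closed: "\<lbrakk>g \<in> space (arr G); h \<in> space (arr G); src G g = rng G h\<rbrakk>
          \<Longrightarrow> mlt G g h \<in> space (arr G)"
    and rng_mlt: "\<lbrakk>g \<in> space (arr G); h \<in> space (arr G); src G g = rng G h\<rbrakk>
          \<Longrightarrow> rng G (mlt G g h) = rng G g"
    and src_mlt: "\<lbrakk>g \<in> space (arr G); h \<in> space (arr G); src G g = rng G h\<rbrakk>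
          \<Longrightarrow> src G (mlt G g h) = src G h"
    and mlt_assoc: "\<lbrakk>g \<in> space (arr G); h \<in> space (arr G); k \<in> space (arr G);
            src G g = rng G h; src G h = rng G k\<rbrakk>
          \<Longrightarrow> mlt G (mlt G g h) k = mlt G g (mlt G h k)"
    and uni_mlt: "g \<in> space (arr G) \<Longrightarrow> mlt G (uni G (rng G g)) g = g"
    and mlt_uni: "g \<in> space (arr G) \<Longrightarrow> mlt G g (uni G (src G g)) = g"
    and ivs_closed: "g \<in> space (arr G) \<Longrightarrow> ivs G g \<in> space (arr G)"
    and rng_ivs: "g \<in> space (arr G) \<Longrightarrow> rng G (ivs G g) = src G g"
    and src_ivs: "g \<in> space (arr G) \<Longrightarrow> src G (ivs G g) = rng G g"
    and mlt_ivs: "g \<in> space (arr G) \<Longrightarrow> mlt G g (ivs G g) = uni G (rng G g)"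
    and ivs_mlt: "g \<in> space (arr G) \<Longrightarrow> mlt G (ivs G g) g = uni G (src G g)"

locale borel_groupoid = groupoid G for G :: "('g, 'u, 'm) groupoid_scheme" +
  assumes standard_arr: "standard_borel (arr G)"
    and standard_obj: "standard_borel (obj G)"
    and rng_borel: "rng G \<in> measurable (arr G) (obj G)"
    and src_borel: "src G \<in> measurable (arr G) (obj G)"
    and uni_borel: "uni G \<in> measurable (obj G) (arr G)"
    and ivs_borel: "ivs G \<in> measurable (arr G) (arr G)"
    and mlt_borel: "(\<lambda>(g, h). mlt G g h) \<in>
          measurable (restrict_space (arr G \<Otimes>\<^sub>M arr G) {(g, h). src G g = rng G h}) (arr G)"

text \<open>
  In \<open>haar_invariant\<close>, the image of \<open>\<lambda>\<^sup>s\<^sup>(\<^sup>\<gamma>\<^sup>)\<close> is taken under \<open>h \<mapsto> \<gamma>h\<close>, which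
  is defined on the fibre of \<open>r\<close> over \<open>s(\<gamma>)\<close> only, hence the restriction. Positivity of \<open>f\<close> is strict,
  so that the Haar measures are sigma-finite.
\<close>

locale borel_haar_groupoid = borel_groupoid G for G :: "('g, 'u, 'm) haar_groupoid_scheme" +
  assumes haar_system: "borel_system (arr G) (obj G) (rng G) (haar G)"
    and haar_invariant: "g \<in> space (arr G) \<Longrightarrow>
          distr (restrict_space (haar G (src G g)) {h \<in> space (arr G). rng G h = src G g}) (arr G) (mlt G g)
            = haar G (rng G g)"
    and haar_proper: "\<exists>f :: 'g \<Rightarrow> real. f \<in> borel_measurable (arr G) \<and> (\<forall>g\<in>space (arr G). f g > 0) \<and>
          (\<forall>u\<in>space (obj G). (\<integral>\<^sup>+ g. ennreal (f g) \<partial>(haar G u)) = 1)"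


section \<open>Measured groupoids\<close>

text \<open>The measure \<open>\<mu> \<circ> \<lambda>\<close>, that is, \<open>f \<mapsto> \<integral>\<integral> f d\<lambda>\<^sup>u d\<mu>(u)\<close>.\<close>

definition arr_meas :: "('g, 'u, 'm) measured_groupoid_scheme \<Rightarrow> 'g measure" where
  "arr_meas M = measure_of (space (arr M)) (sets (arr M))
     (\<lambda>A. \<integral>\<^sup>+ u. emeasure (haar M u) A \<partial>(umeas M))"

definition quasi_invariant :: "('g, 'u, 'm) measured_groupoid_scheme \<Rightarrow> bool" where
  "quasi_invariant M \<longleftrightarrow> sets (umeas M) = sets (obj M) \<and>
     equivalent_measures (arr_meas M) (distr (arr_meas M) (arr M) (ivs M))"

definition ergodic :: "('g, 'u, 'm) measured_groupoid_scheme \<Rightarrow> bool" where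
  "ergodic M \<longleftrightarrow>
     (\<forall>A\<in>sets (obj M). (\<forall>g\<in>space (arr M). rng M g \<in> A \<longleftrightarrow> src M g \<in> A) \<longrightarrow>
        A \<in> null_sets (umeas M) \<or> conull (umeas M) A)"

definition reduction_arrows :: "('g, 'u, 'm) groupoid_scheme \<Rightarrow> 'u set \<Rightarrow> 'g set" where
  "reduction_arrows M U = {g \<in> space (arr M). rng M g \<in> U \<and> src M g \<in> U}"

definition holds_on_composable :: "('g, 'u, 'm) groupoid_scheme \<Rightarrow> 'u set \<Rightarrow> ('g \<Rightarrow> 'g \<Rightarrow> bool) \<Rightarrow> bool" where
  "holds_on_composable M U P \<longleftrightarrow>
     (\<forall>g\<in>reduction_arrows M U. \<forall>h\<in>reduction_arrows M U. src M g = rng M h \<longrightarrow> P g h)"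


section \<open>Spaces with a groupoid action\<close>

record ('g, 'u, 'x) gspace =
  pts :: "'x measure"
  anc :: "'x \<Rightarrow> 'u"
  act :: "'g \<Rightarrow> 'x \<Rightarrow> 'x"

locale gspace =
  fixes G :: "('g, 'u, 'm) groupoid_scheme" and X :: "('g, 'u, 'x, 'n) gspace_scheme"
  assumes standard_pts: "standard_borel (pts X)"
    and anc_borel: "anc X \<in> measurable (pts X) (obj G)"
    and anc_surj: "anc X ` space (pts X) = space (obj G)"
    and act_closed: "\<lbrakk>g \<in> space (arr G); x \<in> space (pts X); src G g = anc X x\<rbrakk>
          \<Longrightarrow> act X g x \<in> space (pts X)"
    and act_borel: "(\<lambda>(g, x). act X g x) \<in>
          measurable (restrict_space (arr G \<Otimes>\<^sub>M pts X) {(g, x). src G g = anc X x}) (pts X)"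
    and anc_act: "\<lbrakk>g \<in> space (arr G); x \<in> space (pts X); src G g = anc X x\<rbrakk>
          \<Longrightarrow> anc X (act X g x) = rng G g"
    and uni_act: "x \<in> space (pts X) \<Longrightarrow> act X (uni G (anc X x)) x = x"
    and mlt_act: "\<lbrakk>g \<in> space (arr G); h \<in> space (arr G); x \<in> space (pts X);
            src G g = rng G h; src G h = anc X x\<rbrakk>
          \<Longrightarrow> act X (mlt G g h) x = act X g (act X h x)"

text \<open>The semi-direct groupoid \<open>X \<rtimes> G\<close> with its Haar system, together with a measure on \<open>X\<close>.\<close>

definition semidirect ::
  "('g, 'u, 'm) haar_groupoid_scheme \<Rightarrow> ('g, 'u, 'x, 'n) gspace_scheme \<Rightarrow> 'x measure
     \<Rightarrow> ('x \<times> 'g, 'x) measured_groupoid" where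
  "semidirect G X \<mu> = \<lparr>
     arr = restrict_space (pts X \<Otimes>\<^sub>M arr G) {(x, g). anc X x = rng G g},
     obj = pts X,
     rng = (\<lambda>(x, g). x),
     src = (\<lambda>(x, g). act X (ivs G g) x),
     uni = (\<lambda>x. (x, uni G (anc X x))),
     mlt = (\<lambda>(x, g) (y, h). (x, mlt G g h)),
     ivs = (\<lambda>(x, g). (act X (ivs G g) x, ivs G g)),
     haar = (\<lambda>x. restrict_space (return (pts X) x \<Otimes>\<^sub>M haar G (anc X x)) {(x, g). anc X x = rng G g}),
     umeas = \<mu>\<rparr>"

definition equivariant ::
  "('g, 'u, 'm) groupoid_scheme \<Rightarrow> ('g, 'u, 'y, 'k) gspace_scheme \<Rightarrow> ('g, 'u, 'x, 'n) gspace_scheme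
     \<Rightarrow> ('y \<Rightarrow> 'x) \<Rightarrow> bool" where
  "equivariant G Y X p \<longleftrightarrow>
     (\<forall>y\<in>space (pts Y). anc X (p y) = anc Y y) \<and>
     (\<forall>g\<in>space (arr G). \<forall>y\<in>space (pts Y). src G g = anc Y y \<longrightarrow> p (act Y g y) = act X g (p y))"

definition measured_pair ::
  "('g, 'u, 'm) haar_groupoid_scheme \<Rightarrow> ('g, 'u, 'y, 'k) gspace_scheme \<Rightarrow> 'y measure
     \<Rightarrow> ('g, 'u, 'x, 'n) gspace_scheme \<Rightarrow> 'x measure \<Rightarrow> ('y \<Rightarrow> 'x) \<Rightarrow> bool" where
  "measured_pair G Y \<nu> X \<mu> p \<longleftrightarrow>
     gspace G Y \<and> gspace G X \<and>
     quasi_invariant (semidirect G Y \<nu>) \<and> quasi_invariant (semidirect G X \<mu>) \<and>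
     p \<in> measurable (pts Y) (pts X) \<and> equivariant G Y X p \<and>
     (\<exists>\<nu>'. finite_measure \<nu>' \<and> equivalent_measures \<nu>' \<nu> \<and> equivalent_measures \<mu> (distr \<nu>' (pts X) p))"

definition ergodic_pair ::
  "('g, 'u, 'm) haar_groupoid_scheme \<Rightarrow> ('g, 'u, 'y, 'k) gspace_scheme \<Rightarrow> 'y measure
     \<Rightarrow> ('g, 'u, 'x, 'n) gspace_scheme \<Rightarrow> 'x measure \<Rightarrow> bool" where
  "ergodic_pair G Y \<nu> X \<mu> \<longleftrightarrow> ergodic (semidirect G Y \<nu>) \<and> ergodic (semidirect G X \<mu>)"

text \<open>
  The image of \<open>\<rho>\<^sup>x\<close> under \<open>y \<mapsto> \<gamma>y\<close> is taken on the domain of this map, which contains the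
  fibre of \<open>p\<close> over \<open>x\<close>.
\<close>

definition measure_preserving_pair ::
  "('g, 'u, 'm) groupoid_scheme \<Rightarrow> ('g, 'u, 'y, 'k) gspace_scheme \<Rightarrow> 'y measure
     \<Rightarrow> ('g, 'u, 'x, 'n) gspace_scheme \<Rightarrow> 'x measure \<Rightarrow> ('y \<Rightarrow> 'x) \<Rightarrow> bool" where
  "measure_preserving_pair G Y \<nu> X \<mu> p \<longleftrightarrow>
     (\<exists>\<rho>. borel_system (pts Y) (pts X) p \<rho> \<and>
          (\<forall>x\<in>space (pts X). prob_space (\<rho> x)) \<and>
          (\<forall>g\<in>space (arr G). \<forall>x\<in>space (pts X). src G g = anc X x \<longrightarrow>
             distr (restrict_space (\<rho> x) {y \<in> space (pts Y). anc Y y = src G g}) (pts Y) (act Y g)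
               = \<rho> (act X g x)) \<and>
          (\<forall>A\<in>sets (pts Y). emeasure \<nu> A = (\<integral>\<^sup>+ x. emeasure (\<rho> x) A \<partial>\<mu>)))"


section \<open>Hilbert bundles\<close>

text \<open>
  Complex Hilbert spaces with explicit carrier; the inner product is linear in its first argument.
\<close>

record 'h hilbert =
  hcar :: "'h set"
  hzero :: "'h"
  hadd :: "'h \<Rightarrow> 'h \<Rightarrow> 'h"
  hscale :: "complex \<Rightarrow> 'h \<Rightarrow> 'h"
  hinner :: "'h \<Rightarrow> 'h \<Rightarrow> complex"

definition hdiff :: "('h, 'm) hilbert_scheme \<Rightarrow> 'h \<Rightarrow> 'h \<Rightarrow> 'h" where
  "hdiff H v w = hadd H v (hscale H (-1) w)"

definition hdist :: "('h, 'm) hilbert_scheme \<Rightarrow> 'h \<Rightarrow> 'h \<Rightarrow> real" where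
  "hdist H v w = sqrt (Re (hinner H (hdiff H v w) (hdiff H v w)))"

locale separable_hilbert_space =
  fixes H :: "('h, 'm) hilbert_scheme"
  assumes zero_closed: "hzero H \<in> hcar H"
    and add_closed: "\<lbrakk>v \<in> hcar H; w \<in> hcar H\<rbrakk> \<Longrightarrow> hadd H v w \<in> hcar H"
    and scale_closed: "v \<in> hcar H \<Longrightarrow> hscale H a v \<in> hcar H"
    and add_assoc: "\<lbrakk>u \<in> hcar H; v \<in> hcar H; w \<in> hcar H\<rbrakk>
          \<Longrightarrow> hadd H (hadd H u v) w = hadd H u (hadd H v w)"
    and add_commute: "\<lbrakk>v \<in> hcar H; w \<in> hcar H\<rbrakk> \<Longrightarrow> hadd H v w = hadd H w v"
    and add_zero: "v \<in> hcar H \<Longrightarrow> hadd H v (hzero H) = v"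
    and add_inverse: "v \<in> hcar H \<Longrightarrow> \<exists>w\<in>hcar H. hadd H v w = hzero H"
    and scale_add_right: "\<lbrakk>v \<in> hcar H; w \<in> hcar H\<rbrakk>
          \<Longrightarrow> hscale H a (hadd H v w) = hadd H (hscale H a v) (hscale H a w)"
    and scale_add_left: "v \<in> hcar H \<Longrightarrow> hscale H (a + b) v = hadd H (hscale H a v) (hscale H b v)"
    and scale_scale: "v \<in> hcar H \<Longrightarrow> hscale H a (hscale H b v) = hscale H (a * b) v"
    and scale_one: "v \<in> hcar H \<Longrightarrow> hscale H 1 v = v"
    and inner_add: "\<lbrakk>u \<in> hcar H; v \<in> hcar H; w \<in> hcar H\<rbrakk>
          \<Longrightarrow> hinner H (hadd H u v) w = hinner H u w + hinner H v w"
    and inner_scale: "\<lbrakk>v \<in> hcar H; w \<in> hcar H\<rbrakk> \<Longrightarrow> hinner H (hscale H a v) w = a * hinner H v w"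
    and inner_commute: "\<lbrakk>v \<in> hcar H; w \<in> hcar H\<rbrakk> \<Longrightarrow> hinner H w v = cnj (hinner H v w)"
    and inner_nonneg: "v \<in> hcar H \<Longrightarrow> 0 \<le> Re (hinner H v v)"
    and inner_definite: "\<lbrakk>v \<in> hcar H; hinner H v v = 0\<rbrakk> \<Longrightarrow> v = hzero H"
    and complete: "\<lbrakk>\<forall>n::nat. f n \<in> hcar H; \<forall>e>0. \<exists>N. \<forall>m\<ge>N. \<forall>n\<ge>N. hdist H (f m) (f n) < e\<rbrakk>
          \<Longrightarrow> \<exists>v\<in>hcar H. (\<lambda>n. hdist H (f n) v) \<longlonglongrightarrow> 0"
    and separable: "\<exists>D. countable D \<and> D \<subseteq> hcar H \<and> (\<forall>v\<in>hcar H. \<forall>e>0. \<exists>w\<in>D. hdist H w v < e)"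

definition hilbert_iso :: "('h, 'm) hilbert_scheme \<Rightarrow> ('h, 'm) hilbert_scheme \<Rightarrow> ('h \<Rightarrow> 'h) \<Rightarrow> bool" where
  "hilbert_iso H K T \<longleftrightarrow>
     bij_betw T (hcar H) (hcar K) \<and>
     (\<forall>v\<in>hcar H. \<forall>w\<in>hcar H. T (hadd H v w) = hadd K (T v) (T w)) \<and>
     (\<forall>a. \<forall>v\<in>hcar H. T (hscale H a v) = hscale K a (T v)) \<and>
     (\<forall>v\<in>hcar H. \<forall>w\<in>hcar H. hinner K (T v) (T w) = hinner H v w)"

text \<open>
  A Borel field of Hilbert spaces over \<open>Z\<close>, given in the usual way by its Borel sections: these are
  sections with Borel inner products, they are saturated under this condition, and some sequence
  of them is dense in every fibre (passing to rational linear combinations, this is the same as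
  some sequence of them being total in every fibre).
\<close>

record ('z, 'h) hbundle =
  fib :: "'z \<Rightarrow> 'h hilbert"
  sections :: "('z \<Rightarrow> 'h) set"

definition hilbert_bundle :: "'z measure \<Rightarrow> ('z, 'h) hbundle \<Rightarrow> bool" where
  "hilbert_bundle Z B \<longleftrightarrow>
     (\<forall>z\<in>space Z. separable_hilbert_space (fib B z)) \<and>
     (\<forall>\<xi>\<in>sections B. \<forall>z\<in>space Z. \<xi> z \<in> hcar (fib B z)) \<and>
     (\<forall>\<xi>\<in>sections B. \<forall>\<eta>\<in>sections B. (\<lambda>z. hinner (fib B z) (\<xi> z) (\<eta> z)) \<in> borel_measurable Z) \<and>
     (\<forall>\<eta>. (\<forall>z\<in>space Z. \<eta> z \<in> hcar (fib B z)) \<and>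
          (\<forall>\<xi>\<in>sections B. (\<lambda>z. hinner (fib B z) (\<eta> z) (\<xi> z)) \<in> borel_measurable Z)
          \<longrightarrow> \<eta> \<in> sections B) \<and>
     (\<exists>e :: nat \<Rightarrow> 'z \<Rightarrow> 'h. (\<forall>n. e n \<in> sections B) \<and>
          (\<forall>z\<in>space Z. \<forall>v\<in>hcar (fib B z). \<forall>\<epsilon>>0. \<exists>n. hdist (fib B z) (e n z) v < \<epsilon>))"

text \<open>
  The pull-back along \<open>q : W \<rightarrow> Z\<close>. The sections pulled back from \<open>Z\<close> contain a pointwise dense
  sequence, so testing against them determines the Borel sections.
\<close>

definition pullback :: "'w measure \<Rightarrow> ('w \<Rightarrow> 'z) \<Rightarrow> ('z, 'h) hbundle \<Rightarrow> ('w, 'h) hbundle" where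
  "pullback W q B = \<lparr>
     fib = (\<lambda>w. fib B (q w)),
     sections = {\<eta>. (\<forall>w\<in>space W. \<eta> w \<in> hcar (fib B (q w))) \<and>
       (\<forall>\<xi>\<in>sections B. (\<lambda>w. hinner (fib B (q w)) (\<eta> w) (\<xi> (q w))) \<in> borel_measurable W)}\<rparr>"


section \<open>Representations and first cohomology\<close>

definition groupoid_rep ::
  "('g, 'u, 'm) measured_groupoid_scheme \<Rightarrow> ('u, 'h) hbundle \<Rightarrow> ('g \<Rightarrow> 'h \<Rightarrow> 'h) \<Rightarrow> bool" where
  "groupoid_rep M B L \<longleftrightarrow>
     (\<forall>g\<in>space (arr M). hilbert_iso (fib B (src M g)) (fib B (rng M g)) (L g)) \<and>
     (\<forall>\<xi>\<in>sections B. \<forall>\<eta>\<in>sections B.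
        (\<lambda>g. hinner (fib B (rng M g)) (L g (\<xi> (src M g))) (\<eta> (rng M g))) \<in> borel_measurable (arr M)) \<and>
     (\<exists>U. conull (umeas M) U \<and>
        holds_on_composable M U (\<lambda>g h. \<forall>v\<in>hcar (fib B (src M h)). L (mlt M g h) v = L g (L h v)))"

text \<open>The Borel maps \<open>b\<close> with \<open>b(\<gamma>) \<in> \<H>(r(\<gamma>))\<close> are the Borel sections of the pull-back of \<open>\<H>\<close> along \<open>r\<close>.\<close>

definition cocycles ::
  "('g, 'u, 'm) measured_groupoid_scheme \<Rightarrow> ('u, 'h) hbundle \<Rightarrow> ('g \<Rightarrow> 'h \<Rightarrow> 'h) \<Rightarrow> ('g \<Rightarrow> 'h) set" where
  "cocycles M B L = {b \<in> sections (pullback (arr M) (rng M) B).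
     \<exists>U. conull (umeas M) U \<and>
       holds_on_composable M U (\<lambda>g h. b (mlt M g h) = hadd (fib B (rng M g)) (b g) (L g (b h)))}"

definition coboundary ::
  "('g, 'u, 'm) measured_groupoid_scheme \<Rightarrow> ('u, 'h) hbundle \<Rightarrow> ('g \<Rightarrow> 'h \<Rightarrow> 'h) \<Rightarrow> ('g \<Rightarrow> 'h) \<Rightarrow> bool" where
  "coboundary M B L b \<longleftrightarrow>
     (\<exists>\<xi>\<in>sections B. AE g in arr_meas M.
        b g = hdiff (fib B (rng M g)) (\<xi> (rng M g)) (L g (\<xi> (src M g))))"

text \<open>
  Cocycles that agree almost everywhere are cohomologous (take \<open>\<xi> = 0\<close>), so the quotient by this
  relation also performs the identification modulo almost everywhere equality.
\<close>

definition cohomologous ::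
  "('g, 'u, 'm) measured_groupoid_scheme \<Rightarrow> ('u, 'h) hbundle \<Rightarrow> ('g \<Rightarrow> 'h \<Rightarrow> 'h)
     \<Rightarrow> (('g \<Rightarrow> 'h) \<times> ('g \<Rightarrow> 'h)) set" where
  "cohomologous M B L = {(b, c). b \<in> cocycles M B L \<and> c \<in> cocycles M B L \<and>
     coboundary M B L (\<lambda>g. hdiff (fib B (rng M g)) (b g) (c g))}"

definition H1 ::
  "('g, 'u, 'm) measured_groupoid_scheme \<Rightarrow> ('u, 'h) hbundle \<Rightarrow> ('g \<Rightarrow> 'h \<Rightarrow> 'h) \<Rightarrow> ('g \<Rightarrow> 'h) set set" where
  "H1 M B L = cocycles M B L // cohomologous M B L"

text \<open>The map induced by \<open>b \<mapsto> b \<circ> f\<close> on classes, with values in the cohomology of \<open>(M, B, L)\<close>.\<close>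

definition H1_map ::
  "('g, 'u, 'm) measured_groupoid_scheme \<Rightarrow> ('u, 'h) hbundle \<Rightarrow> ('g \<Rightarrow> 'h \<Rightarrow> 'h)
     \<Rightarrow> ('g \<Rightarrow> 'g') \<Rightarrow> ('g' \<Rightarrow> 'h) set \<Rightarrow> ('g \<Rightarrow> 'h) set" where
  "H1_map M B L f C = (\<Union>b\<in>C. cohomologous M B L `` {b \<circ> f})"

definition semidirect_hom :: "('y \<Rightarrow> 'x) \<Rightarrow> 'y \<times> 'g \<Rightarrow> 'x \<times> 'g" where
  "semidirect_hom p = (\<lambda>(y, g). (p y, g))"

end

theory Submission
  imports Defs
begin

text \<open>
  Suppose that \<open>b \<circ> \<phi>\<close> is the coboundary of a section \<open>\<eta>\<close> over \<open>Y\<close>. For each \<open>x\<close> let \<open>m\<^sup>x\<close> be the image of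
  \<open>\<rho>\<^sup>x\<close> under \<open>\<eta>\<close>, a probability measure on \<open>\<H>(x)\<close>. Invariance of \<open>\<rho>\<close> and Fubini's theorem show that for
  almost every \<open>(x, \<gamma>)\<close> the affine isometry \<open>v \<mapsto> b(x, \<gamma>) + L(x, \<gamma>) v\<close> carries \<open>m\<close> at \<open>\<gamma>\<^sup>-\<^sup>1x\<close> to \<open>m\<^sup>x\<close>.
  Every probability measure on a separable Hilbert space has a centre that is equivariant under affine
  isometries, although its barycentre need not exist: restrict the measure to a canonically chosen
  bounded set of positive measure and take the mean there. The centre \<open>\<xi>(x)\<close> of \<open>m\<^sup>x\<close> is then a Borel
  section over \<open>X\<close> with \<open>b(x, \<gamma>) = \<xi>(x) - L(x, \<gamma>) \<xi>(\<gamma>\<^sup>-\<^sup>1x)\<close> almost everywhere.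
\<close>

section \<open>Hilbert spaces with explicit carrier\<close>

text \<open>The barycentre of \<open>m\<close> may fail to exist because \<eta> is merely Borel,
  with no moment bound on the fibres. The threshold one half makes a canonical choice possible: two
  sets of mass above one half in a probability space intersect, so no base point is chosen, and the
  construction uses only distances and masses, which affine isometries preserve. The measures
  \<open>m\<close> are never formed on the Hilbert spaces. Sets of vectors are replaced by their
  preimages in \<open>Y\<close>, and Borel questions are settled there through the kernel \<rho>;
  the mean itself is a weak integral, obtained from the Riesz representation. Fubini's theorem
  enters because the exceptional set lies in the product of \<open>Y\<close> and \<open>G\<close>.
  Disintegration yields the order \<open>x\<close>, \<open>y\<close>, \<gamma> of the quantifiers,
  while transporting a fibre measure by one fixed arrow requires the order \<open>x\<close>,
  \<gamma>, \<open>y\<close>. The exchange is possible since the Haar measure attached to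
  \<open>y\<close> depends on \<open>p y\<close> only. Injectivity on classes follows by descending
  the difference of two cocycles.\<close>

definition hnorm :: "('h, 'm) hilbert_scheme \<Rightarrow> 'h \<Rightarrow> real" where
  "hnorm H v = sqrt (Re (hinner H v v))"

lemma hdist_eq_hnorm: "hdist H v w = hnorm H (hdiff H v w)"
  by (simp add: hdist_def hnorm_def)

context separable_hilbert_space
begin

lemma diff_closed: "v \<in> hcar H \<Longrightarrow> w \<in> hcar H \<Longrightarrow> hdiff H v w \<in> hcar H"
  by (simp add: hdiff_def add_closed scale_closed)

lemmas closed = zero_closed add_closed scale_closed diff_closed

lemma scale_zero: "v \<in> hcar H \<Longrightarrow> hscale H 0 v = hzero H"
  by (rule inner_definite) (simp_all add: scale_closed inner_scale)

lemma inner_zero_left: "w \<in> hcar H \<Longrightarrow> hinner H (hzero H) w = 0"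
  using inner_scale[of "hzero H" w 0] scale_zero[OF zero_closed] zero_closed by simp

lemma inner_zero_right: "w \<in> hcar H \<Longrightarrow> hinner H w (hzero H) = 0"
  using inner_commute[of "hzero H" w] inner_zero_left[of w] zero_closed by simp

lemma inner_add_right:
  "\<lbrakk>u \<in> hcar H; v \<in> hcar H; w \<in> hcar H\<rbrakk> \<Longrightarrow> hinner H u (hadd H v w) = hinner H u v + hinner H u w"
  using inner_commute[of "hadd H v w" u] inner_commute[of v u] inner_commute[of w u] inner_add[of v w u]
  by (simp add: add_closed)

lemma inner_scale_right:
  "\<lbrakk>v \<in> hcar H; w \<in> hcar H\<rbrakk> \<Longrightarrow> hinner H v (hscale H a w) = cnj a * hinner H v w"
  using inner_commute[of "hscale H a w" v] inner_commute[of w v] inner_scale[of w v a]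
  by (simp add: scale_closed)

lemma inner_diff_left:
  "\<lbrakk>u \<in> hcar H; v \<in> hcar H; w \<in> hcar H\<rbrakk> \<Longrightarrow> hinner H (hdiff H u v) w = hinner H u w - hinner H v w"
  by (simp add: hdiff_def inner_add inner_scale scale_closed)

lemma inner_diff_right:
  "\<lbrakk>u \<in> hcar H; v \<in> hcar H; w \<in> hcar H\<rbrakk> \<Longrightarrow> hinner H u (hdiff H v w) = hinner H u v - hinner H u w"
  by (simp add: hdiff_def inner_add_right inner_scale_right scale_closed)

lemmas inner_simps = inner_zero_left inner_zero_right inner_add inner_add_right inner_scale
  inner_scale_right inner_diff_left inner_diff_right

text \<open>Definiteness applied to the difference. This is the working tool for vector identities
  below: testing against all \<open>v\<close> turns them into identities between complex numbers,
  which \<open>inner_simps\<close> settles.\<close>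

lemma inner_ext:
  assumes u: "u \<in> hcar H" and w: "w \<in> hcar H"
    and eq: "\<And>v. v \<in> hcar H \<Longrightarrow> hinner H u v = hinner H w v"
  shows "u = w"
proof -
  have "hdiff H u w = hzero H"
    by (rule inner_definite) (use u w eq in \<open>simp_all add: closed inner_diff_left\<close>)
  moreover have "hadd H (hscale H (-1) w) w = hzero H"
    using scale_add_left[OF w, of "-1" 1] by (simp add: scale_one w scale_zero)
  then have "hadd H (hdiff H u w) w = u"
    by (simp add: hdiff_def u w add_assoc closed add_zero)
  moreover have "hadd H (hzero H) w = w"
    using add_commute[OF zero_closed w] w by (simp add: add_zero)
  ultimately show ?thesis by simp
qed

lemma inner_self: "v \<in> hcar H \<Longrightarrow> hinner H v v = complex_of_real (Re (hinner H v v))"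
  using inner_commute[of v v] by (simp add: complex_eq_iff)

lemma hnorm_nonneg: "v \<in> hcar H \<Longrightarrow> 0 \<le> hnorm H v"
  by (simp add: hnorm_def inner_nonneg)

lemma hnorm_sq: "v \<in> hcar H \<Longrightarrow> (hnorm H v)\<^sup>2 = Re (hinner H v v)"
  by (simp add: hnorm_def inner_nonneg)

lemma cauchy_schwarz:
  assumes u: "u \<in> hcar H" and v: "v \<in> hcar H"
  shows "cmod (hinner H u v) \<le> hnorm H u * hnorm H v"
proof (cases "hinner H v v = 0")
  case True
  then have "v = hzero H" using inner_definite v by blast
  then show ?thesis using u v by (simp add: inner_zero_right hnorm_nonneg)
next
  case False
  define n where "n = Re (hinner H v v)"
  have nv: "hinner H v v = of_real n" using inner_self[OF v] by (simp add: n_def)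
  have n: "n > 0" using False nv inner_nonneg[OF v] unfolding n_def[symmetric] by (cases "n = 0") auto
  define c where "c = hinner H u v"
  \<comment> \<open>The coefficient of the orthogonal projection of \<open>u\<close> onto the line
    of \<open>v\<close>; the inequality is the nonnegativity of the squared norm of the
    remainder.\<close>
  define t where "t = c / of_real n"
  have vu: "hinner H v u = cnj c" using inner_commute[OF u v] by (simp add: c_def)
  have "0 \<le> Re (hinner H (hdiff H u (hscale H t v)) (hdiff H u (hscale H t v)))"
    using u v by (intro inner_nonneg) (simp add: closed)
  also have "hinner H (hdiff H u (hscale H t v)) (hdiff H u (hscale H t v))
      = hinner H u u - cnj t * c - t * cnj c + t * cnj t * of_real n"
    using u v by (simp add: inner_simps closed nv vu c_def[symmetric] algebra_simps)
  also have "t * cnj t * of_real n = t * cnj c"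
    using n by (simp add: t_def)
  also have "hinner H u u - cnj t * c - t * cnj c + t * cnj c = hinner H u u - of_real ((cmod c)\<^sup>2 / n)"
    using n complex_norm_square[of c] by (simp add: t_def mult.commute)
  finally have "(cmod c)\<^sup>2 / n \<le> (hnorm H u)\<^sup>2" by (simp add: hnorm_sq u)
  then have "(cmod c)\<^sup>2 \<le> (hnorm H u)\<^sup>2 * n" using n by (simp add: field_simps)
  also have "\<dots> = (hnorm H u * hnorm H v)\<^sup>2"
    using v by (simp add: power_mult_distrib hnorm_sq n_def)
  finally show ?thesis
    unfolding c_def by (rule power2_le_imp_le) (simp add: hnorm_nonneg u v)
qed

lemma hnorm_add_sq:
  assumes "u \<in> hcar H" "v \<in> hcar H"
  shows "(hnorm H (hadd H u v))\<^sup>2 = (hnorm H u)\<^sup>2 + 2 * Re (hinner H u v) + (hnorm H v)\<^sup>2"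
  using assms inner_commute[OF assms] by (simp add: hnorm_sq closed inner_simps)

lemma hnorm_diff_sq:
  assumes "u \<in> hcar H" "v \<in> hcar H"
  shows "(hnorm H (hdiff H u v))\<^sup>2 = (hnorm H u)\<^sup>2 - 2 * Re (hinner H u v) + (hnorm H v)\<^sup>2"
  using assms inner_commute[OF assms] by (simp add: hnorm_sq closed inner_simps)

lemma hnorm_triangle:
  assumes "u \<in> hcar H" "v \<in> hcar H"
  shows "hnorm H (hadd H u v) \<le> hnorm H u + hnorm H v"
proof (rule power2_le_imp_le)
  have "Re (hinner H u v) \<le> hnorm H u * hnorm H v"
    using cauchy_schwarz[OF assms] complex_Re_le_cmod order_trans by blast
  then show "(hnorm H (hadd H u v))\<^sup>2 \<le> (hnorm H u + hnorm H v)\<^sup>2"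
    using assms by (simp add: hnorm_add_sq power2_sum)
qed (use assms in \<open>simp add: hnorm_nonneg\<close>)

lemma hdist_triangle:
  assumes "u \<in> hcar H" "v \<in> hcar H" "w \<in> hcar H"
  shows "hdist H u w \<le> hdist H u v + hdist H v w"
proof -
  have "hdiff H u w = hadd H (hdiff H u v) (hdiff H v w)"
    by (rule inner_ext) (use assms in \<open>simp_all add: inner_simps closed\<close>)
  then show ?thesis
    using hnorm_triangle[of "hdiff H u v" "hdiff H v w"] assms
    by (simp add: hdist_eq_hnorm closed)
qed

lemma hdist_commute:
  assumes "u \<in> hcar H" "v \<in> hcar H"
  shows "hdist H u v = hdist H v u"
  using assms inner_commute[OF assms] by (simp add: hdist_def inner_simps closed)

lemma hdist_zero: "u \<in> hcar H \<Longrightarrow> hdist H u (hzero H) = hnorm H u"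
  by (simp add: hdist_def hnorm_def inner_simps closed)

lemma hnorm_le_dist:
  assumes "u \<in> hcar H" "v \<in> hcar H"
  shows "hnorm H u \<le> hnorm H v + hdist H u v"
  using hdist_triangle[of u v "hzero H"] assms by (simp add: hdist_zero zero_closed)

text \<open>The linear terms cancel against the midpoint, and what remains is the parallelogram law.
  Hence two near-minimisers of \<open>J\<close> are close to each other, which is the Cauchy
  estimate for the Riesz representation.\<close>

lemma parallelogram_defect:
  fixes l :: "'h \<Rightarrow> complex"
  assumes add: "\<And>u v. \<lbrakk>u \<in> hcar H; v \<in> hcar H\<rbrakk> \<Longrightarrow> l (hadd H u v) = l u + l v"
    and scale: "\<And>a u. u \<in> hcar H \<Longrightarrow> l (hscale H a u) = a * l u"
    and J: "J = (\<lambda>v. (hnorm H v)\<^sup>2 - 2 * Re (l v))"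
    and uv: "u \<in> hcar H" "v \<in> hcar H"
  shows "(hdist H u v)\<^sup>2 = 2 * (J u + J v - 2 * J (hscale H (1/2) (hadd H u v)))"
proof -
  have "(hnorm H (hscale H (1/2) (hadd H u v)))\<^sup>2 = (hnorm H (hadd H u v))\<^sup>2 / 4"
    using uv by (simp add: hnorm_sq closed inner_scale inner_scale_right)
  moreover have "Re (l (hscale H (1/2) (hadd H u v))) = (Re (l u) + Re (l v)) / 2"
    using uv by (simp add: scale add closed)
  moreover have "(hdist H u v)\<^sup>2 + (hnorm H (hadd H u v))\<^sup>2 = 2 * (hnorm H u)\<^sup>2 + 2 * (hnorm H v)\<^sup>2"
    using uv by (simp add: hdist_eq_hnorm hnorm_diff_sq hnorm_add_sq)
  ultimately show ?thesis by (simp add: J field_simps)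
qed

text \<open>A minimising sequence of \<open>\<parallel>v\<parallel>\<^sup>2 - 2 Re l(v)\<close> is Cauchy, and its limit represents \<open>l\<close>.\<close>

theorem riesz_representation:
  fixes l :: "'h \<Rightarrow> complex"
  assumes add: "\<And>u v. \<lbrakk>u \<in> hcar H; v \<in> hcar H\<rbrakk> \<Longrightarrow> l (hadd H u v) = l u + l v"
    and scale: "\<And>a u. u \<in> hcar H \<Longrightarrow> l (hscale H a u) = a * l u"
    and bound: "\<And>u. u \<in> hcar H \<Longrightarrow> cmod (l u) \<le> C * hnorm H u"
  shows "\<exists>w\<in>hcar H. \<forall>u\<in>hcar H. l u = hinner H u w"
proof -
  define J where "J = (\<lambda>v. (hnorm H v)\<^sup>2 - 2 * Re (l v))"
  \<comment> \<open>Completing the square: \<open>J v\<close> is at least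
    \<open>(hnorm H v - C)\<^sup>2 - C\<^sup>2\<close>.\<close>
  have J_ge: "- C\<^sup>2 \<le> J v" if "v \<in> hcar H" for v
  proof -
    have "Re (l v) \<le> C * hnorm H v"
      using bound[OF that] complex_Re_le_cmod order_trans by blast
    moreover have "0 \<le> (hnorm H v - C)\<^sup>2" by simp
    ultimately show ?thesis by (simp add: J_def power2_diff algebra_simps)
  qed
  define m where "m = (INF v\<in>hcar H. J v)"
  have bdd: "bdd_below (J ` hcar H)" using J_ge by (intro bdd_belowI2)
  have m_le: "m \<le> J v" if "v \<in> hcar H" for v
    unfolding m_def using bdd that by (rule cINF_lower)
  have "\<exists>v\<in>hcar H. J v < m + 1 / Suc k" for k :: nat
  proof (rule ccontr)
    assume "\<not> ?thesis"
    then have "m + 1 / Suc k \<le> m"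
      unfolding m_def using zero_closed by (intro cINF_greatest) (auto simp: not_less)
    then show False by simp
  qed
  then obtain f where f: "\<And>k. f k \<in> hcar H" "\<And>k. J (f k) < m + 1 / Suc k" by metis
  have dist: "(hdist H (f i) (f j))\<^sup>2 < 2 / Suc i + 2 / Suc j" for i j
  proof -
    define h where "h = hscale H (1/2) (hadd H (f i) (f j))"
    have "m \<le> J h" unfolding h_def by (intro m_le closed f)
    moreover have "(hdist H (f i) (f j))\<^sup>2 = 2 * (J (f i) + J (f j) - 2 * J h)"
      unfolding h_def by (rule parallelogram_defect[OF _ _ J_def]) (simp_all add: add scale f)
    moreover have "2 * J (f i) < 2 * m + 2 / Suc i" "2 * J (f j) < 2 * m + 2 / Suc j"
      using f(2)[of i] f(2)[of j] by (simp_all add: field_simps)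
    ultimately show ?thesis by simp
  qed
  have "\<forall>e>0. \<exists>N. \<forall>i\<ge>N. \<forall>j\<ge>N. hdist H (f i) (f j) < e"
  proof (intro allI impI)
    fix e :: real assume e: "e > 0"
    \<comment> \<open>Chosen so that each of the two summands in \<open>dist\<close> is at most half
      of the square of \<open>e\<close>.\<close>
    then obtain N where N: "4 / e\<^sup>2 < real N" using reals_Archimedean2 by blast
    have "hdist H (f i) (f j) < e" if "i \<ge> N" "j \<ge> N" for i j
    proof -
      have s: "2 / real (Suc k) \<le> e\<^sup>2 / 2" if "k \<ge> N" for k
      proof -
        have "4 / e\<^sup>2 \<le> real (Suc k)" using N that by linarith
        then show ?thesis using e by (simp add: field_simps)
      qed
      have "(hdist H (f i) (f j))\<^sup>2 < e\<^sup>2"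
        using dist[of i j] s[OF that(1)] s[OF that(2)] by linarith
      then show ?thesis using e by (meson less_imp_le power_less_imp_less_base)
    qed
    then show "\<exists>N. \<forall>i\<ge>N. \<forall>j\<ge>N. hdist H (f i) (f j) < e" by blast
  qed
  then obtain w where w: "w \<in> hcar H" and lim: "(\<lambda>n. hdist H (f n) w) \<longlonglongrightarrow> 0"
    using complete[of f] f(1) by blast
  have Re_eq: "Re (hinner H u w) = Re (l u)" if u: "u \<in> hcar H" for u
  proof -
    \<comment> \<open>Half the derivative of \<open>J\<close> at \<open>v\<close> in the direction
      \<open>u\<close>. It is continuous in \<open>v\<close>, so the first-order condition can be
      obtained at \<open>w\<close> by a limit along \<open>f\<close>.\<close>
    define D where "D = (\<lambda>v. Re (hinner H u v) - Re (l u))"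
    have "(\<lambda>n. hinner H u (f n) - hinner H u w) \<longlonglongrightarrow> 0"
    proof (rule Lim_null_comparison)
      show "\<forall>\<^sub>F n in sequentially. cmod (hinner H u (f n) - hinner H u w) \<le> hnorm H u * hdist H (f n) w"
        using cauchy_schwarz[OF u diff_closed[OF f(1) w]] u w f(1)
        by (simp add: inner_diff_right hdist_eq_hnorm)
      show "(\<lambda>n. hnorm H u * hdist H (f n) w) \<longlonglongrightarrow> 0"
        using tendsto_mult_right_zero[OF lim] by simp
    qed
    then have "(\<lambda>n. hinner H u (f n)) \<longlonglongrightarrow> hinner H u w" by (simp add: LIM_zero_iff)
    then have D_lim: "(\<lambda>n. D (f n)) \<longlonglongrightarrow> D w"
      unfolding D_def by (intro tendsto_intros)
    \<comment> \<open>Minimality is applied to \<open>f n\<close> moved by \<open>t\<close> times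
      \<open>u\<close>; the resulting inequality has error \<open>1 / Suc n\<close> and passes to
      the limit through \<open>D\<close>, without evaluating \<open>J\<close> at
      \<open>w\<close>.\<close>
    have key: "0 \<le> 2 * t * D w + t\<^sup>2 * (hnorm H u)\<^sup>2" for t :: real
    proof -
      have "J (hadd H (f n) (hscale H (of_real t) u)) = J (f n) + 2 * t * D (f n) + t\<^sup>2 * (hnorm H u)\<^sup>2" for n
      proof -
        have "Re (hinner H (f n) u) = Re (hinner H u (f n))"
          using inner_commute[OF u f(1)] by simp
        then show ?thesis
          using u f(1)[of n]
          by (simp add: J_def D_def hnorm_sq closed inner_simps add scale power2_eq_square[of t] algebra_simps)
      qed
      then have "0 \<le> 1 / Suc n + 2 * t * D (f n) + t\<^sup>2 * (hnorm H u)\<^sup>2" for n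
        using m_le[of "hadd H (f n) (hscale H (of_real t) u)"] f(2)[of n] u f(1)[of n]
        by (simp add: closed)
      moreover have "(\<lambda>n. 1 / Suc n + 2 * t * D (f n) + t\<^sup>2 * (hnorm H u)\<^sup>2)
          \<longlonglongrightarrow> 0 + 2 * t * D w + t\<^sup>2 * (hnorm H u)\<^sup>2"
        by (intro tendsto_intros D_lim) (use LIMSEQ_inverse_real_of_nat in \<open>simp add: inverse_eq_divide\<close>)
      ultimately show ?thesis by (intro LIMSEQ_le_const[of _ _ 0]) auto
    qed
    have "D w = 0"
    proof (cases "hnorm H u = 0")
      case True
      then show ?thesis using key[of 1] key[of "-1"] by simp
    next
      case False
      define q where "q = (hnorm H u)\<^sup>2"
      have "q > 0" using False by (simp add: q_def)
      \<comment> \<open>This value of \<open>t\<close> minimises the quadratic polynomial in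
        \<open>key\<close>; the minimum is negative unless \<open>D w\<close> vanishes.\<close>
      have "0 \<le> 2 * (- D w / q) * D w + (- D w / q)\<^sup>2 * q"
        using key[of "- D w / q"] by (simp add: q_def)
      also have "\<dots> = - ((D w)\<^sup>2 / q)" using \<open>q > 0\<close> by (simp add: power2_eq_square field_simps)
      finally show ?thesis using \<open>q > 0\<close> by (simp add: divide_le_0_iff)
    qed
    then show ?thesis by (simp add: D_def)
  qed
  \<comment> \<open>Applying the equality of real parts to \<open>u\<close> multiplied by the
    imaginary unit gives the equality of imaginary parts.\<close>
  have "l u = hinner H u w" if u: "u \<in> hcar H" for u
    using Re_eq[OF u] Re_eq[of "hscale H \<i> u"] u w
    by (simp add: scale closed inner_scale complex_eq_iff)
  then show ?thesis using w by blast
qed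

end

lemma hilbert_iso_closed: "hilbert_iso H K T \<Longrightarrow> v \<in> hcar H \<Longrightarrow> T v \<in> hcar K"
  unfolding hilbert_iso_def using bij_betwE by blast

lemma hilbert_iso_add:
  "\<lbrakk>hilbert_iso H K T; v \<in> hcar H; w \<in> hcar H\<rbrakk> \<Longrightarrow> T (hadd H v w) = hadd K (T v) (T w)"
  by (simp add: hilbert_iso_def)

lemma hilbert_iso_scale:
  "\<lbrakk>hilbert_iso H K T; v \<in> hcar H\<rbrakk> \<Longrightarrow> T (hscale H a v) = hscale K a (T v)"
  by (simp add: hilbert_iso_def)


section \<open>Borel sections of Hilbert bundles\<close>

lemma fib_pullback: "fib (pullback W q B) = (\<lambda>w. fib B (q w))"
  by (simp add: pullback_def)

lemma sections_pullback_iff: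
  "\<eta> \<in> sections (pullback W q B) \<longleftrightarrow> (\<forall>w\<in>space W. \<eta> w \<in> hcar (fib B (q w))) \<and>
     (\<forall>\<xi>\<in>sections B. (\<lambda>w. hinner (fib B (q w)) (\<eta> w) (\<xi> (q w))) \<in> borel_measurable W)"
  by (simp add: pullback_def)

text \<open>Meant for fibre products, where the maps to the base through the two projections agree
  on the carrier set but not as total functions.\<close>

lemma sections_pullback_cong:
  assumes "\<And>w. w \<in> space W \<Longrightarrow> q w = q' w"
  shows "sections (pullback W q B) = sections (pullback W q' B)"
proof -
  have "(\<lambda>w. hinner (fib B (q w)) (\<eta> w) (\<xi> (q w))) \<in> borel_measurable W
      \<longleftrightarrow> (\<lambda>w. hinner (fib B (q' w)) (\<eta> w) (\<xi> (q' w))) \<in> borel_measurable W" for \<eta> \<xi>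
    by (rule measurable_cong) (simp add: assms)
  then show ?thesis by (simp add: pullback_def assms cong: ball_cong)
qed

locale borel_hilbert_bundle =
  fixes Z :: "'z measure" and B :: "('z, 'h) hbundle"
  assumes is_bundle: "hilbert_bundle Z B"
begin

lemma fib_hilbert: "z \<in> space Z \<Longrightarrow> separable_hilbert_space (fib B z)"
  using is_bundle unfolding hilbert_bundle_def by (elim conjE) (drule (1) bspec | assumption)+

lemma section_closed: "\<xi> \<in> sections B \<Longrightarrow> z \<in> space Z \<Longrightarrow> \<xi> z \<in> hcar (fib B z)"
  using is_bundle unfolding hilbert_bundle_def by (elim conjE) (drule (1) bspec | assumption)+

lemma section_inner_measurable:
  "\<xi> \<in> sections B \<Longrightarrow> \<eta> \<in> sections B \<Longrightarrow> (\<lambda>z. hinner (fib B z) (\<xi> z) (\<eta> z)) \<in> borel_measurable Z"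
  using is_bundle unfolding hilbert_bundle_def by (elim conjE) (drule (1) bspec | assumption)+

lemma sectionI:
  assumes "\<And>z. z \<in> space Z \<Longrightarrow> \<eta> z \<in> hcar (fib B z)"
    and "\<And>\<xi>. \<xi> \<in> sections B \<Longrightarrow> (\<lambda>z. hinner (fib B z) (\<eta> z) (\<xi> z)) \<in> borel_measurable Z"
  shows "\<eta> \<in> sections B"
proof -
  have "\<forall>\<eta>. (\<forall>z\<in>space Z. \<eta> z \<in> hcar (fib B z)) \<and>
      (\<forall>\<xi>\<in>sections B. (\<lambda>z. hinner (fib B z) (\<eta> z) (\<xi> z)) \<in> borel_measurable Z) \<longrightarrow> \<eta> \<in> sections B"
    using is_bundle unfolding hilbert_bundle_def by (elim conjE)
  with assms show ?thesis by blast
qed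

lemma dense_sequence:
  "\<exists>e :: nat \<Rightarrow> 'z \<Rightarrow> 'h. (\<forall>n. e n \<in> sections B) \<and>
    (\<forall>z\<in>space Z. \<forall>v\<in>hcar (fib B z). \<forall>\<epsilon>>0. \<exists>n. hdist (fib B z) (e n z) v < \<epsilon>)"
  using is_bundle unfolding hilbert_bundle_def by (elim conjE)

section \<open>Pull-backs of Hilbert bundles along a Borel map\<close>

context
  fixes W :: "'w measure" and q :: "'w \<Rightarrow> 'z"
  assumes q: "q \<in> measurable W Z"
begin

lemma fib_hilbert_pullback: "w \<in> space W \<Longrightarrow> separable_hilbert_space (fib B (q w))"
  using measurable_space[OF q] by (rule fib_hilbert)

lemma pullback_closed:
  "\<eta> \<in> sections (pullback W q B) \<Longrightarrow> w \<in> space W \<Longrightarrow> \<eta> w \<in> hcar (fib B (q w))"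
  by (simp add: sections_pullback_iff)

lemma pullback_inner_section:
  "\<eta> \<in> sections (pullback W q B) \<Longrightarrow> \<xi> \<in> sections B \<Longrightarrow>
    (\<lambda>w. hinner (fib B (q w)) (\<eta> w) (\<xi> (q w))) \<in> borel_measurable W"
  by (simp add: sections_pullback_iff)

lemma section_closed_pullback: "\<xi> \<in> sections B \<Longrightarrow> w \<in> space W \<Longrightarrow> \<xi> (q w) \<in> hcar (fib B (q w))"
  using measurable_space[OF q] by (intro section_closed)

lemma section_comp: "\<xi> \<in> sections B \<Longrightarrow> (\<lambda>w. \<xi> (q w)) \<in> sections (pullback W q B)"
  unfolding sections_pullback_iff
  using section_closed_pullback measurable_compose[OF q section_inner_measurable] by blast

text \<open>The identity \<open>2 Re \<langle>v, e\<rangle> - \<parallel>e\<parallel>\<^sup>2 = \<parallel>v\<parallel>\<^sup>2 - \<parallel>v - e\<parallel>\<^sup>2\<close> exhibits the norm as a countable supremum.\<close>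

lemma pullback_norm_measurable:
  assumes \<eta>: "\<eta> \<in> sections (pullback W q B)"
  shows "(\<lambda>w. hnorm (fib B (q w)) (\<eta> w)) \<in> borel_measurable W"
proof -
  obtain e :: "nat \<Rightarrow> 'z \<Rightarrow> 'h" where e_dense: "(\<forall>n. e n \<in> sections B) \<and>
      (\<forall>z\<in>space Z. \<forall>v\<in>hcar (fib B z). \<forall>\<epsilon>>0. \<exists>n. hdist (fib B z) (e n z) v < \<epsilon>)"
    using dense_sequence by (rule exE)
  then have e: "e n \<in> sections B" for n by simp
  have dense: "\<exists>n. hdist (fib B z) (e n z) v < \<epsilon>"
    if "z \<in> space Z" "v \<in> hcar (fib B z)" "\<epsilon> > 0" for z v \<epsilon>
    using e_dense that by simp
  define F where "F = (\<lambda>n w. 2 * Re (hinner (fib B (q w)) (\<eta> w) (e n (q w)))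
    - Re (hinner (fib B (q w)) (e n (q w)) (e n (q w))))"
  have [measurable]: "(\<lambda>w. hinner (fib B (q w)) (\<eta> w) (e n (q w))) \<in> borel_measurable W"
    "(\<lambda>w. hinner (fib B (q w)) (e n (q w)) (e n (q w))) \<in> borel_measurable W" for n
    using pullback_inner_section[OF \<eta> e] pullback_inner_section[OF section_comp[OF e] e] by auto
  \<comment> \<open>Taken in \<open>ereal\<close>, the countable supremum is Borel without a prior
    bound; that it is finite emerges from its value.\<close>
  have "(\<lambda>w. SUP n. ereal (F n w)) \<in> borel_measurable W"
    unfolding F_def by measurable
  moreover have "(SUP n. ereal (F n w)) = ereal ((hnorm (fib B (q w)) (\<eta> w))\<^sup>2)" if w: "w \<in> space W" for w
  proof -
    interpret H: separable_hilbert_space "fib B (q w)" using w by (rule fib_hilbert_pullback)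
    have v: "\<eta> w \<in> hcar (fib B (q w))" using pullback_closed[OF \<eta> w] .
    have en: "e n (q w) \<in> hcar (fib B (q w))" for n using section_closed_pullback[OF e w] .
    have F: "F n w = (hnorm (fib B (q w)) (\<eta> w))\<^sup>2 - (hdist (fib B (q w)) (e n (q w)) (\<eta> w))\<^sup>2" for n
      using v en[of n] H.hdist_commute[OF en[of n] v]
      by (simp add: F_def hdist_eq_hnorm H.hnorm_diff_sq H.hnorm_sq)
    show ?thesis
    proof (rule antisym)
      show "(SUP n. ereal (F n w)) \<le> ereal ((hnorm (fib B (q w)) (\<eta> w))\<^sup>2)"
        by (rule SUP_least) (simp add: F)
      show "ereal ((hnorm (fib B (q w)) (\<eta> w))\<^sup>2) \<le> (SUP n. ereal (F n w))"
      proof (rule ereal_le_epsilon2)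
        fix d :: real assume d: "d > 0"
        then obtain n where n: "hdist (fib B (q w)) (e n (q w)) (\<eta> w) < sqrt d"
          using dense[OF measurable_space[OF q w] v, of "sqrt d"] by auto
        have "0 \<le> hdist (fib B (q w)) (e n (q w)) (\<eta> w)"
          using v en by (simp add: hdist_eq_hnorm H.hnorm_nonneg H.diff_closed)
        then have "(hdist (fib B (q w)) (e n (q w)) (\<eta> w))\<^sup>2 \<le> d"
          using n d by (metis less_imp_le power_mono real_sqrt_pow2)
        then have "ereal ((hnorm (fib B (q w)) (\<eta> w))\<^sup>2) \<le> ereal (F n w) + ereal d"
          by (simp add: F)
        also have "ereal (F n w) \<le> (SUP n. ereal (F n w))" by (rule SUP_upper) simp
        finally show "ereal ((hnorm (fib B (q w)) (\<eta> w))\<^sup>2) \<le> (SUP n. ereal (F n w)) + ereal d"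
          by (simp add: add_right_mono)
      qed
    qed
  qed
  ultimately have "(\<lambda>w. ereal ((hnorm (fib B (q w)) (\<eta> w))\<^sup>2)) \<in> borel_measurable W"
    by (simp cong: measurable_cong)
  then have "(\<lambda>w. real_of_ereal (ereal ((hnorm (fib B (q w)) (\<eta> w))\<^sup>2))) \<in> borel_measurable W"
    by (rule borel_measurable_real_of_ereal)
  then have "(\<lambda>w. (hnorm (fib B (q w)) (\<eta> w))\<^sup>2) \<in> borel_measurable W" by simp
  then have "(\<lambda>w. sqrt ((hnorm (fib B (q w)) (\<eta> w))\<^sup>2)) \<in> borel_measurable W"
    by (rule measurable_compose) (rule borel_measurable_sqrt)
  moreover have "sqrt ((hnorm (fib B (q w)) (\<eta> w))\<^sup>2) = hnorm (fib B (q w)) (\<eta> w)" if w: "w \<in> space W" for w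
    using separable_hilbert_space.hnorm_nonneg[OF fib_hilbert_pullback[OF w] pullback_closed[OF \<eta> w]] by simp
  ultimately show ?thesis by (simp cong: measurable_cong)
qed

lemma pullback_add:
  assumes \<eta>: "\<eta> \<in> sections (pullback W q B)" "\<zeta> \<in> sections (pullback W q B)"
  shows "(\<lambda>w. hadd (fib B (q w)) (\<eta> w) (\<zeta> w)) \<in> sections (pullback W q B)"
  unfolding sections_pullback_iff
proof (intro conjI ballI)
  fix w assume w: "w \<in> space W"
  interpret H: separable_hilbert_space "fib B (q w)" using w by (rule fib_hilbert_pullback)
  show "hadd (fib B (q w)) (\<eta> w) (\<zeta> w) \<in> hcar (fib B (q w))"
    by (intro H.closed pullback_closed \<eta> w)
next
  fix \<xi> assume \<xi>: "\<xi> \<in> sections B"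
  have "hinner (fib B (q w)) (hadd (fib B (q w)) (\<eta> w) (\<zeta> w)) (\<xi> (q w))
    = hinner (fib B (q w)) (\<eta> w) (\<xi> (q w)) + hinner (fib B (q w)) (\<zeta> w) (\<xi> (q w))" if w: "w \<in> space W" for w
    by (intro separable_hilbert_space.inner_add fib_hilbert_pullback pullback_closed
        section_closed_pullback \<xi> \<eta> w)
  moreover have "(\<lambda>w. hinner (fib B (q w)) (\<eta> w) (\<xi> (q w)) + hinner (fib B (q w)) (\<zeta> w) (\<xi> (q w)))
      \<in> borel_measurable W"
    by (intro borel_measurable_add pullback_inner_section \<xi> \<eta>)
  ultimately show "(\<lambda>w. hinner (fib B (q w)) (hadd (fib B (q w)) (\<eta> w) (\<zeta> w)) (\<xi> (q w))) \<in> borel_measurable W"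
    by (simp cong: measurable_cong)
qed

lemma pullback_scale:
  assumes \<eta>: "\<eta> \<in> sections (pullback W q B)"
  shows "(\<lambda>w. hscale (fib B (q w)) a (\<eta> w)) \<in> sections (pullback W q B)"
  unfolding sections_pullback_iff
proof (intro conjI ballI)
  fix w assume w: "w \<in> space W"
  show "hscale (fib B (q w)) a (\<eta> w) \<in> hcar (fib B (q w))"
    by (intro separable_hilbert_space.scale_closed fib_hilbert_pullback pullback_closed \<eta> w)
next
  fix \<xi> assume \<xi>: "\<xi> \<in> sections B"
  have "hinner (fib B (q w)) (hscale (fib B (q w)) a (\<eta> w)) (\<xi> (q w))
    = a * hinner (fib B (q w)) (\<eta> w) (\<xi> (q w))" if w: "w \<in> space W" for w
    by (intro separable_hilbert_space.inner_scale fib_hilbert_pullback pullback_closed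
        section_closed_pullback \<xi> \<eta> w)
  moreover have "(\<lambda>w. a * hinner (fib B (q w)) (\<eta> w) (\<xi> (q w))) \<in> borel_measurable W"
    by (intro borel_measurable_times borel_measurable_const pullback_inner_section \<xi> \<eta>)
  ultimately show "(\<lambda>w. hinner (fib B (q w)) (hscale (fib B (q w)) a (\<eta> w)) (\<xi> (q w))) \<in> borel_measurable W"
    by (simp cong: measurable_cong)
qed

lemma pullback_diff:
  "\<lbrakk>\<eta> \<in> sections (pullback W q B); \<zeta> \<in> sections (pullback W q B)\<rbrakk>
    \<Longrightarrow> (\<lambda>w. hdiff (fib B (q w)) (\<eta> w) (\<zeta> w)) \<in> sections (pullback W q B)"
  unfolding hdiff_def by (intro pullback_add pullback_scale)

lemma pullback_zero: "(\<lambda>w. hzero (fib B (q w))) \<in> sections (pullback W q B)"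
  unfolding sections_pullback_iff
proof (intro conjI ballI)
  fix w assume w: "w \<in> space W"
  show "hzero (fib B (q w)) \<in> hcar (fib B (q w))"
    by (intro separable_hilbert_space.zero_closed fib_hilbert_pullback w)
next
  fix \<xi> assume \<xi>: "\<xi> \<in> sections B"
  have "hinner (fib B (q w)) (hzero (fib B (q w))) (\<xi> (q w)) = 0" if w: "w \<in> space W" for w
    by (intro separable_hilbert_space.inner_zero_left fib_hilbert_pullback section_closed_pullback \<xi> w)
  then show "(\<lambda>w. hinner (fib B (q w)) (hzero (fib B (q w))) (\<xi> (q w))) \<in> borel_measurable W"
    by (simp cong: measurable_cong)
qed

lemma pullback_dist_measurable:
  "\<lbrakk>\<eta> \<in> sections (pullback W q B); \<zeta> \<in> sections (pullback W q B)\<rbrakk>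
    \<Longrightarrow> (\<lambda>w. hdist (fib B (q w)) (\<eta> w) (\<zeta> w)) \<in> borel_measurable W"
  unfolding hdist_eq_hnorm by (intro pullback_norm_measurable pullback_diff)

text \<open>The definition of the pull-back tests only against sections coming from
  \<open>Z\<close>. For two arbitrary sections, polarisation reduces to norms:
  \<open>P \<zeta>\<close> is the real part of the inner product, and replacing \<zeta> by its
  multiple with the imaginary unit produces the imaginary part.\<close>

lemma pullback_inner_measurable:
  assumes \<eta>: "\<eta> \<in> sections (pullback W q B)" "\<zeta> \<in> sections (pullback W q B)"
  shows "(\<lambda>w. hinner (fib B (q w)) (\<eta> w) (\<zeta> w)) \<in> borel_measurable W"
proof -
  define P where "P = (\<lambda>\<zeta> w. ((hnorm (fib B (q w)) (hadd (fib B (q w)) (\<eta> w) (\<zeta> w)))\<^sup>2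
    - (hnorm (fib B (q w)) (\<eta> w))\<^sup>2 - (hnorm (fib B (q w)) (\<zeta> w))\<^sup>2) / 2)"
  have P: "P \<zeta> \<in> borel_measurable W" if "\<zeta> \<in> sections (pullback W q B)" for \<zeta>
    unfolding P_def
    by (intro borel_measurable_divide borel_measurable_diff borel_measurable_power borel_measurable_const
        pullback_norm_measurable pullback_add \<eta> that)
  have "(\<lambda>w. Complex (P \<zeta> w) (P (\<lambda>w. hscale (fib B (q w)) \<i> (\<zeta> w)) w)) \<in> borel_measurable W"
    unfolding borel_measurable_complex_iff by (simp add: P pullback_scale \<eta>)
  moreover have "Complex (P \<zeta> w) (P (\<lambda>w. hscale (fib B (q w)) \<i> (\<zeta> w)) w)
      = hinner (fib B (q w)) (\<eta> w) (\<zeta> w)" if w: "w \<in> space W" for w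
  proof -
    interpret H: separable_hilbert_space "fib B (q w)" using w by (rule fib_hilbert_pullback)
    show ?thesis
      using pullback_closed[OF \<eta>(1) w] pullback_closed[OF \<eta>(2) w]
      by (simp add: P_def H.hnorm_add_sq H.closed H.inner_scale_right complex_eq_iff)
  qed
  ultimately show ?thesis by (simp cong: measurable_cong)
qed

lemma hilbert_bundle_pullback: "hilbert_bundle W (pullback W q B)"
proof -
  obtain e :: "nat \<Rightarrow> 'z \<Rightarrow> 'h" where e_dense: "(\<forall>n. e n \<in> sections B) \<and>
      (\<forall>z\<in>space Z. \<forall>v\<in>hcar (fib B z). \<forall>\<epsilon>>0. \<exists>n. hdist (fib B z) (e n z) v < \<epsilon>)"
    using dense_sequence by (rule exE)
  then have e: "e n \<in> sections B" for n by simp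
  have dense: "\<exists>n. hdist (fib B z) (e n z) v < \<epsilon>"
    if "z \<in> space Z" "v \<in> hcar (fib B z)" "\<epsilon> > 0" for z v \<epsilon>
    using e_dense that by simp
  have "\<eta> \<in> sections (pullback W q B)"
    if "\<forall>w\<in>space W. \<eta> w \<in> hcar (fib B (q w))"
      "\<forall>\<zeta>\<in>sections (pullback W q B). (\<lambda>w. hinner (fib B (q w)) (\<eta> w) (\<zeta> w)) \<in> borel_measurable W" for \<eta>
    unfolding sections_pullback_iff[of \<eta>]
    by (intro conjI ballI) (use that section_comp in \<open>auto dest: bspec\<close>)
  moreover have "\<exists>e :: nat \<Rightarrow> 'w \<Rightarrow> 'h. (\<forall>n. e n \<in> sections (pullback W q B)) \<and>
      (\<forall>w\<in>space W. \<forall>v\<in>hcar (fib B (q w)). \<forall>\<epsilon>>0. \<exists>n. hdist (fib B (q w)) (e n w) v < \<epsilon>)"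
    using dense measurable_space[OF q]
    by (intro exI[of _ "\<lambda>n w. e n (q w)"]) (simp add: section_comp e)
  ultimately show ?thesis
    unfolding hilbert_bundle_def fib_pullback
    by (intro conjI ballI allI impI) (auto intro: fib_hilbert_pullback pullback_closed pullback_inner_measurable)
qed

lemma pullback_comp:
  assumes \<eta>: "\<eta> \<in> sections (pullback W q B)" and f: "f \<in> measurable V W"
  shows "(\<lambda>v. \<eta> (f v)) \<in> sections (pullback V (\<lambda>v. q (f v)) B)"
  unfolding sections_pullback_iff
  using pullback_closed[OF \<eta>] measurable_space[OF f] measurable_compose[OF f pullback_inner_section[OF \<eta>]]
  by blast

end

text \<open>Pulling back in two steps tests against all sections over \<open>W\<close>, in one step
  only against those coming from \<open>Z\<close>. The gap is closed by the measurability of inner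
  products of two arbitrary pulled-back sections.\<close>

lemma sections_pullback_pullback:
  assumes q: "q \<in> measurable W Z" and f: "f \<in> measurable V W"
  shows "sections (pullback V f (pullback W q B)) = sections (pullback V (\<lambda>v. q (f v)) B)"
proof (intro set_eqI iffI)
  fix \<eta> assume "\<eta> \<in> sections (pullback V f (pullback W q B))"
  then have "\<And>v. v \<in> space V \<Longrightarrow> \<eta> v \<in> hcar (fib B (q (f v)))"
    and *: "\<And>\<xi>. \<xi> \<in> sections (pullback W q B) \<Longrightarrow>
      (\<lambda>v. hinner (fib B (q (f v))) (\<eta> v) (\<xi> (f v))) \<in> borel_measurable V"
    by (simp_all add: sections_pullback_iff[of _ V f] fib_pullback)
  moreover have "(\<lambda>v. hinner (fib B (q (f v))) (\<eta> v) (\<xi> (q (f v)))) \<in> borel_measurable V"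
    if "\<xi> \<in> sections B" for \<xi>
    using *[OF section_comp[OF q that]] .
  ultimately show "\<eta> \<in> sections (pullback V (\<lambda>v. q (f v)) B)"
    by (simp add: sections_pullback_iff[of _ V])
next
  fix \<eta> assume \<eta>: "\<eta> \<in> sections (pullback V (\<lambda>v. q (f v)) B)"
  have "(\<lambda>v. hinner (fib B (q (f v))) (\<eta> v) (\<xi> (f v))) \<in> borel_measurable V"
    if "\<xi> \<in> sections (pullback W q B)" for \<xi>
    by (rule pullback_inner_measurable[OF measurable_compose[OF f q] \<eta> pullback_comp[OF q that f]])
  then show "\<eta> \<in> sections (pullback V f (pullback W q B))"
    using \<eta> by (simp add: sections_pullback_iff[of _ V] fib_pullback)
qed

end


section \<open>Equivariant centres of fibre measures\<close>

text \<open>A countable base of a metrizable topology separates points, so equality of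
  \<open>f\<close> and \<open>g\<close> is a countable conjunction of Borel conditions. This makes
  the fibres of \<open>p\<close>, the fibre product of \<open>Y\<close> with itself and the arrows
  of a semi-direct groupoid Borel sets.\<close>

lemma standard_borel_diagonal:
  assumes M: "standard_borel M" and f: "f \<in> measurable N M" and g: "g \<in> measurable N M"
  shows "{w \<in> space N. f w = g w} \<in> sets N"
proof -
  obtain T where T: "completely_metrizable_space T" "second_countable T" "topspace T = space M"
      "sets M = sigma_sets (space M) {U. openin T U}"
    using M by (auto simp: standard_borel_def)
  obtain \<B> where \<B>: "countable \<B>" "\<And>V. V \<in> \<B> \<Longrightarrow> openin T V"
      "\<And>U x. openin T U \<Longrightarrow> x \<in> U \<Longrightarrow> \<exists>V\<in>\<B>. x \<in> V \<and> V \<subseteq> U"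
    using T(2) unfolding second_countable_def by metis
  have t1: "t1_space T"
    using T(1) completely_metrizable_imp_metrizable_space metrizable_imp_t1_space by blast
  have sep: "a = b" if ab: "a \<in> space M" "b \<in> space M" "\<And>V. V \<in> \<B> \<Longrightarrow> a \<in> V \<longleftrightarrow> b \<in> V" for a b
  proof (rule ccontr)
    assume "a \<noteq> b"
    then obtain U where "openin T U" "a \<in> U" "b \<notin> U"
      using t1 ab(1,2) T(3) unfolding t1_space_def by metis
    then show False using \<B>(3)[of U a] ab(3) by blast
  qed
  have "V \<in> sets M" if "V \<in> \<B>" for V
    using \<B>(2)[OF that] T(4) by auto
  then have "f -` V \<inter> space N \<in> sets N" "g -` V \<inter> space N \<in> sets N" if "V \<in> \<B>" for V
    using measurable_sets[OF f] measurable_sets[OF g] that by auto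
  then have "{w \<in> space N. f w \<in> V \<longleftrightarrow> g w \<in> V} \<in> sets N" if "V \<in> \<B>" for V
  proof -
    have "{w \<in> space N. f w \<in> V \<longleftrightarrow> g w \<in> V} =
        space N - ((f -` V \<inter> space N - g -` V \<inter> space N) \<union> (g -` V \<inter> space N - f -` V \<inter> space N))"
      by auto
    then show ?thesis using \<open>\<And>V. V \<in> \<B> \<Longrightarrow> f -` V \<inter> space N \<in> sets N\<close>[OF that]
        \<open>\<And>V. V \<in> \<B> \<Longrightarrow> g -` V \<inter> space N \<in> sets N\<close>[OF that] by (simp only:) blast
  qed
  then have "{w \<in> space N. \<forall>V\<in>\<B>. f w \<in> V \<longleftrightarrow> g w \<in> V} \<in> sets N"
    using \<B>(1) by (rule sets.sets_Collect_countable_All')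
  also have "{w \<in> space N. \<forall>V\<in>\<B>. f w \<in> V \<longleftrightarrow> g w \<in> V} = {w \<in> space N. f w = g w}"
    using sep measurable_space[OF f] measurable_space[OF g] by auto
  finally show ?thesis .
qed

section \<open>Fibre measures as a probability kernel\<close>

locale prob_system =
  fixes Y :: "'y measure" and X :: "'x measure" and p :: "'y \<Rightarrow> 'x" and \<rho> :: "'x \<Rightarrow> 'y measure"
  assumes system: "borel_system Y X p \<rho>"
    and fibre_prob: "x \<in> space X \<Longrightarrow> prob_space (\<rho> x)"
    and standard_base: "standard_borel X"
begin

lemma p_measurable [measurable]: "p \<in> measurable Y X"
  using system by (simp add: borel_system_def)

lemma p_space: "y \<in> space Y \<Longrightarrow> p y \<in> space X"
  using measurable_space[OF p_measurable] .

lemma sets_fibre: "x \<in> space X \<Longrightarrow> sets (\<rho> x) = sets Y"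
  using system by (simp add: borel_system_def)

lemma space_fibre: "x \<in> space X \<Longrightarrow> space (\<rho> x) = space Y"
  using sets_eq_imp_space_eq[OF sets_fibre] .

lemma AE_fibre: "x \<in> space X \<Longrightarrow> AE y in \<rho> x. p y = x"
  using system space_fibre[of x] by (intro AE_I'[of "{y \<in> space Y. p y \<noteq> x}"]) (auto simp: borel_system_def)

text \<open>As an element of the subprobability algebra, \<rho> also integrates functions and
  measures sets that vary with the base point in a Borel way.\<close>

lemma kernel [measurable]: "\<rho> \<in> measurable X (subprob_algebra Y)"
proof (rule measurable_subprob_algebra)
  show "subprob_space (\<rho> x)" if "x \<in> space X" for x
    using fibre_prob[OF that] by (rule prob_space_imp_subprob_space)
  show "sets (\<rho> x) = sets Y" if "x \<in> space X" for x using that by (rule sets_fibre)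
  fix A assume A: "A \<in> sets Y"
  then have "(\<lambda>x. \<integral>\<^sup>+ y. indicator A y \<partial>(\<rho> x)) \<in> borel_measurable X"
    using system by (simp add: borel_system_def)
  moreover have "(\<integral>\<^sup>+ y. indicator A y \<partial>(\<rho> x)) = emeasure (\<rho> x) A" if "x \<in> space X" for x
    using A sets_fibre[OF that] by simp
  ultimately show "(\<lambda>x. emeasure (\<rho> x) A) \<in> borel_measurable X" by (simp cong: measurable_cong)
qed

lemma fibre_sets [measurable]: "Measurable.pred Y (\<lambda>y. p y = x)" if "x \<in> space X"
  unfolding pred_def using standard_borel_diagonal[OF standard_base p_measurable measurable_const[OF that]] .

lemma same_fibre_sets [measurable]: "Measurable.pred (Y \<Otimes>\<^sub>M Y) (\<lambda>w. p (snd w) = p (fst w))"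
  unfolding pred_def by (rule standard_borel_diagonal[OF standard_base]) measurable

end

text \<open>
  The image of \<open>\<rho>\<^sup>x\<close> under \<open>\<eta>\<close> is a probability measure \<open>m\<close> on the fibre over \<open>x\<close>. A vector is
  \<open>r\<close>-concentrated if its open \<open>r\<close>-ball has \<open>m\<close>-measure above one half. Any two such balls meet, so the
  \<open>r\<close>-concentrated vectors form a bounded set, of positive \<open>m\<close>-measure for some \<open>r\<close>. The mean of
  \<open>m\<close> over this set for the least such integer \<open>r\<close> is a point that depends equivariantly on \<open>m\<close>.
\<close>

locale fibred_section = prob_system Y X p \<rho> + borel_hilbert_bundle X B
  for Y :: "'y measure" and X :: "'x measure" and p \<rho> and B :: "('x, 'h) hbundle" +
  fixes \<eta> :: "'y \<Rightarrow> 'h"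
  assumes \<eta>: "\<eta> \<in> sections (pullback Y p B)"
begin

text \<open>The open ball around \<open>\<eta> y\<close> in the fibre over \<open>p y\<close>,
  encoded by its preimage under \<eta>. This keeps the construction inside the Borel space
  \<open>Y\<close>, with no Borel structure on the total space of the bundle.\<close>

definition near :: "real \<Rightarrow> 'y \<Rightarrow> 'y set" where
  "near r y = {y' \<in> space Y. p y' = p y \<and> hdist (fib B (p y)) (\<eta> y) (\<eta> y') < r}"

definition concentrated :: "real \<Rightarrow> 'y set" where
  "concentrated r = {y \<in> space Y. 1 / 2 < measure (\<rho> (p y)) (near r y)}"

definition radius :: "'x \<Rightarrow> nat" where
  "radius x = (LEAST n. measure (\<rho> x) (concentrated (real n)) \<noteq> 0)"

text \<open>Each fibre uses its own radius, but all fibres are collected into one Borel subset of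
  \<open>Y\<close>, so that integrals over the core depend on \<open>x\<close> through the
  kernel.\<close>

definition core :: "'y set" where
  "core = {y \<in> space Y. y \<in> concentrated (real (radius (p y)))}"

lemma closed_at: "y \<in> space Y \<Longrightarrow> \<eta> y \<in> hcar (fib B (p y))"
  using \<eta> by (simp add: sections_pullback_iff)

text \<open>The distance between two values of \<eta> makes sense only if both lie in the same
  Hilbert space, so measurability is proved on the fibre product \<open>?D\<close> and then
  transferred to the full product, in which \<open>?D\<close> is Borel.\<close>

lemma near_rel_sets: "(SIGMA y:space Y. near r y) \<in> sets (Y \<Otimes>\<^sub>M Y)"
proof -
  let ?D = "restrict_space (Y \<Otimes>\<^sub>M Y) {w. p (snd w) = p (fst w)}"
  have D: "{w. p (snd w) = p (fst w)} \<inter> space (Y \<Otimes>\<^sub>M Y) \<in> sets (Y \<Otimes>\<^sub>M Y)"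
    using same_fibre_sets unfolding pred_def by (simp add: Int_def conj_commute)
  have [measurable]: "fst \<in> measurable ?D Y" "snd \<in> measurable ?D Y"
    by (simp_all add: measurable_restrict_space1)
  have "(\<lambda>w. \<eta> (snd w)) \<in> sections (pullback ?D (\<lambda>w. p (snd w)) B)"
    by (rule pullback_comp[OF p_measurable \<eta>]) measurable
  \<comment> \<open>Now both copies of \<eta> are sections of one bundle over \<open>?D\<close>, and
    their distance is Borel.\<close>
  then have "(\<lambda>w. \<eta> (snd w)) \<in> sections (pullback ?D (\<lambda>w. p (fst w)) B)"
    by (rule back_subst) (rule sections_pullback_cong, simp add: space_restrict_space)
  then have "(\<lambda>w. hdist (fib B (p (fst w))) (\<eta> (fst w)) (\<eta> (snd w))) \<in> borel_measurable ?D"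
    by (intro pullback_dist_measurable pullback_comp[OF p_measurable \<eta>]) measurable
  then have "{w \<in> space ?D. hdist (fib B (p (fst w))) (\<eta> (fst w)) (\<eta> (snd w)) < r} \<in> sets ?D"
    by measurable
  moreover have "{w \<in> space ?D. hdist (fib B (p (fst w))) (\<eta> (fst w)) (\<eta> (snd w)) < r}
      = (SIGMA y:space Y. near r y)"
    by (auto simp: near_def space_restrict_space space_pair_measure)
  ultimately show ?thesis using sets_restrict_space_iff[OF D] by auto
qed

lemma near_sets: "y \<in> space Y \<Longrightarrow> near r y \<in> sets Y"
  using sets_Pair1[OF near_rel_sets, of y r] by (simp add: vimage_def)

lemma concentrated_sets [measurable]: "concentrated r \<in> sets Y"
proof -
  have [measurable]: "(\<lambda>y. measure (\<rho> (p y)) (near r y)) \<in> borel_measurable Y"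
    by (rule measure_measurable_subprob_algebra2[OF near_rel_sets]) measurable
  show ?thesis unfolding concentrated_def by measurable
qed

lemma radius_measurable [measurable]: "radius \<in> measurable X (count_space UNIV)"
  unfolding radius_def by measurable

lemma core_sets [measurable]: "core \<in> sets Y"
proof -
  have "core = {y \<in> space Y. \<exists>n. radius (p y) = n \<and> y \<in> concentrated (real n)}"
    by (auto simp: core_def)
  also have "\<dots> \<in> sets Y" by measurable
  finally show ?thesis .
qed

lemma core_fibre: "y \<in> space Y \<Longrightarrow> y \<in> core \<longleftrightarrow> y \<in> concentrated (real (radius (p y)))"
  by (simp add: core_def)

text \<open>The balls around the origin exhaust the fibre, hence one of them has mass above one
  half, and all its points are concentrated for twice its radius.\<close>

lemma ex_concentrated:
  assumes x: "x \<in> space X"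
  shows "\<exists>n. measure (\<rho> x) (concentrated (real n)) \<noteq> 0"
proof -
  interpret P: prob_space "\<rho> x" using x by (rule fibre_prob)
  interpret H: separable_hilbert_space "fib B x" using x by (rule fib_hilbert)
  \<comment> \<open>The norm is written in the fibre over \<open>p y\<close>, not over
    \<open>x\<close>, so that measurability of norms of sections applies to it.\<close>
  define A where "A = (\<lambda>k::nat. {y \<in> space Y. p y = x \<and> hnorm (fib B (p y)) (\<eta> y) < real k})"
  have [measurable]: "(\<lambda>y. hnorm (fib B (p y)) (\<eta> y)) \<in> borel_measurable Y"
    by (rule pullback_norm_measurable[OF p_measurable \<eta>])
  note fibre_sets[OF x, measurable]
  have A: "A k \<in> sets (\<rho> x)" for k
    unfolding sets_fibre[OF x] A_def by measurable
  have "(\<lambda>k. measure (\<rho> x) (A k)) \<longlonglongrightarrow> measure (\<rho> x) (\<Union>k. A k)"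
    using A by (intro P.finite_Lim_measure_incseq) (auto simp: A_def incseq_def)
  moreover have "measure (\<rho> x) (\<Union>k. A k) = 1"
  proof -
    have "AE y in \<rho> x. y \<in> (\<Union>k. A k)"
      using AE_fibre[OF x] AE_space
      by eventually_elim (auto simp: A_def space_fibre[OF x] reals_Archimedean2)
    then show ?thesis using A P.prob_eq_1[of "\<Union>k. A k"] by auto
  qed
  ultimately have "\<forall>\<^sub>F k in sequentially. 1 / 2 < measure (\<rho> x) (A k)"
    by (intro order_tendstoD(1)[of _ 1]) auto
  then obtain k where k: "1 / 2 < measure (\<rho> x) (A k)"
    by (auto simp: eventually_sequentially)
  \<comment> \<open>Two vectors of norm below \<open>k\<close> are less than \<open>2 * k\<close>
    apart, so the ball of that radius around any point of \<open>A k\<close> contains all of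
    \<open>A k\<close>.\<close>
  have "A k \<subseteq> concentrated (real (2 * k))"
  proof
    fix y assume y: "y \<in> A k"
    have "A k \<subseteq> near (real (2 * k)) y"
    proof
      fix y' assume y': "y' \<in> A k"
      have c: "\<eta> y \<in> hcar (fib B x)" "\<eta> y' \<in> hcar (fib B x)"
        using y y' closed_at[of y] closed_at[of y'] by (auto simp: A_def)
      have "hdist (fib B x) (\<eta> y) (\<eta> y') \<le> hnorm (fib B x) (\<eta> y) + hnorm (fib B x) (\<eta> y')"
        using H.hdist_triangle[OF c(1) H.zero_closed c(2)] H.hdist_zero[OF c(1)] H.hdist_zero[OF c(2)]
          H.hdist_commute[OF c(2) H.zero_closed] by simp
      then show "y' \<in> near (real (2 * k)) y" using y y' by (auto simp: A_def near_def)
    qed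
    then have "measure (\<rho> x) (A k) \<le> measure (\<rho> x) (near (real (2 * k)) y)"
      using y by (intro P.finite_measure_mono) (auto simp: near_sets sets_fibre[OF x] A_def)
    then show "y \<in> concentrated (real (2 * k))"
      using k y by (auto simp: concentrated_def A_def)
  qed
  then have "measure (\<rho> x) (A k) \<le> measure (\<rho> x) (concentrated (real (2 * k)))"
    by (intro P.finite_measure_mono) (auto simp: sets_fibre[OF x])
  then show ?thesis using k by (intro exI[of _ "2 * k"]) linarith
qed

lemma measure_core:
  assumes x: "x \<in> space X"
  shows "measure (\<rho> x) core = measure (\<rho> x) (concentrated (real (radius x)))"
proof (rule measure_eq_AE)
  show "AE y in \<rho> x. y \<in> core \<longleftrightarrow> y \<in> concentrated (real (radius x))"
    using AE_fibre[OF x] AE_space by eventually_elim (auto simp: core_fibre space_fibre[OF x])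
qed (simp_all add: sets_fibre[OF x])

lemma measure_core_pos: "x \<in> space X \<Longrightarrow> 0 < measure (\<rho> x) core"
proof -
  assume x: "x \<in> space X"
  have "measure (\<rho> x) (concentrated (real (radius x))) \<noteq> 0"
    unfolding radius_def using ex_concentrated[OF x] by (rule LeastI_ex)
  then show ?thesis unfolding measure_core[OF x] using measure_nonneg by (rule le_neq_trans[OF _ not_sym, rotated])
qed

lemma core_bounded:
  assumes y: "y \<in> core" "y' \<in> core" "p y = p y'"
  shows "hdist (fib B (p y)) (\<eta> y) (\<eta> y') \<le> 2 * real (radius (p y))"
proof -
  define x where "x = p y"
  have Y: "y \<in> space Y" "y' \<in> space Y" using y by (auto simp: core_def)
  then have x: "x \<in> space X" by (simp add: x_def p_space)
  interpret P: prob_space "\<rho> x" using x by (rule fibre_prob)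
  interpret H: separable_hilbert_space "fib B x" using x by (rule fib_hilbert)
  define r where "r = real (radius x)"
  have half: "1 / 2 < measure (\<rho> x) (near r y)" "1 / 2 < measure (\<rho> x) (near r y')"
    using y by (simp_all add: core_def concentrated_def r_def x_def)
  have "near r y \<inter> near r y' \<noteq> {}"
  proof
    assume "near r y \<inter> near r y' = {}"
    then have "measure (\<rho> x) (near r y \<union> near r y') = measure (\<rho> x) (near r y) + measure (\<rho> x) (near r y')"
      using Y by (intro P.finite_measure_Union) (auto simp: near_sets sets_fibre[OF x])
    then show False using half P.prob_le_1[of "near r y \<union> near r y'"] by linarith
  qed
  then obtain z where z: "z \<in> near r y" "z \<in> near r y'" by blast
  then have zs: "z \<in> space Y" "p z = x"
    "hdist (fib B x) (\<eta> y) (\<eta> z) < r" "hdist (fib B x) (\<eta> y') (\<eta> z) < r"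
    using y(3) by (auto simp: near_def x_def)
  have c: "\<eta> y \<in> hcar (fib B x)" "\<eta> y' \<in> hcar (fib B x)" "\<eta> z \<in> hcar (fib B x)"
    using closed_at[OF Y(1)] closed_at[OF Y(2)] closed_at[OF zs(1)] y(3) zs by (auto simp: x_def)
  show ?thesis
    using H.hdist_triangle[OF c(1) c(3) c(2)] H.hdist_commute[OF c(2) c(3)] zs
    by (simp add: x_def[symmetric] r_def[symmetric])
qed

text \<open>The default 0 off the fibre gives a total function of \<open>y\<close> while
  \<open>hinner (fib B x)\<close> is applied only to vectors of its own space.\<close>

definition pairing :: "'x \<Rightarrow> 'h \<Rightarrow> 'y \<Rightarrow> complex" where
  "pairing x v y = (if y \<in> core \<and> p y = x then hinner (fib B x) v (\<eta> y) else 0)"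

lemma pairing_measurable:
  assumes x: "x \<in> space X" and v: "v \<in> hcar (fib B x)"
  shows "pairing x v \<in> borel_measurable Y"
proof -
  interpret H: separable_hilbert_space "fib B x" using x by (rule fib_hilbert)
  note fibre_sets[OF x, measurable]
  have q: "(\<lambda>_. x) \<in> measurable Y X" using x by simp
  \<comment> \<open>Extension of \<eta> by zero from one fibre of \<open>p\<close> to a section of a
    constant bundle over \<open>Y\<close>, where inner products with the constant vector
    \<open>v\<close> are Borel.\<close>
  define \<zeta> where "\<zeta> y = (if p y = x then \<eta> y else hzero (fib B x))" for y
  have const: "(\<lambda>_. v) \<in> sections (pullback Y (\<lambda>_. x) B)"
    using v by (simp add: sections_pullback_iff)
  have "\<zeta> \<in> sections (pullback Y (\<lambda>_. x) B)"
    unfolding sections_pullback_iff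
  proof (intro conjI ballI)
    show "\<zeta> y \<in> hcar (fib B x)" if "y \<in> space Y" for y
      using closed_at[OF that] by (auto simp: \<zeta>_def H.zero_closed)
    fix \<xi> assume \<xi>: "\<xi> \<in> sections B"
    have [measurable]: "(\<lambda>y. hinner (fib B (p y)) (\<eta> y) (\<xi> (p y))) \<in> borel_measurable Y"
      by (rule pullback_inner_section[OF p_measurable \<eta> \<xi>])
    have "(\<lambda>y. if p y = x then hinner (fib B (p y)) (\<eta> y) (\<xi> (p y)) else 0) \<in> borel_measurable Y"
      by measurable
    also have "(\<lambda>y. if p y = x then hinner (fib B (p y)) (\<eta> y) (\<xi> (p y)) else 0)
        = (\<lambda>y. hinner (fib B x) (\<zeta> y) (\<xi> x))"
      using section_closed[OF \<xi> x] by (auto simp: \<zeta>_def H.inner_zero_left)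
    finally show "(\<lambda>y. hinner (fib B x) (\<zeta> y) (\<xi> x)) \<in> borel_measurable Y" .
  qed
  then have [measurable]: "(\<lambda>y. hinner (fib B x) v (\<zeta> y)) \<in> borel_measurable Y"
    using pullback_inner_measurable[OF q const] by simp
  have "pairing x v = (\<lambda>y. if y \<in> core \<and> p y = x then hinner (fib B x) v (\<zeta> y) else 0)"
    by (auto simp: pairing_def \<zeta>_def)
  also have "\<dots> \<in> borel_measurable Y" by measurable
  finally show ?thesis .
qed

text \<open>All core vectors over \<open>x\<close> lie within \<open>2 * radius x\<close> of any one
  of them, so their norms are bounded and the Cauchy-Schwarz inequality applies. The constant is
  uniform in \<open>v\<close>: it serves both integrability and the Riesz bound.\<close>

lemma pairing_bounded:
  assumes x: "x \<in> space X"
  shows "\<exists>C. \<forall>v\<in>hcar (fib B x). \<forall>y\<in>space Y. cmod (pairing x v y) \<le> C * hnorm (fib B x) v"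
proof (cases "\<exists>y0\<in>core. p y0 = x")
  case False
  interpret H: separable_hilbert_space "fib B x" using x by (rule fib_hilbert)
  show ?thesis using False by (intro exI[of _ 0]) (auto simp: pairing_def)
next
  case True
  interpret H: separable_hilbert_space "fib B x" using x by (rule fib_hilbert)
  obtain y0 where y0: "y0 \<in> core" "p y0 = x" using True by blast
  have c0: "\<eta> y0 \<in> hcar (fib B x)" using closed_at[of y0] y0 by (auto simp: core_def)
  define C where "C = hnorm (fib B x) (\<eta> y0) + 2 * real (radius x)"
  have C: "0 \<le> C" by (simp add: C_def H.hnorm_nonneg c0)
  have "cmod (pairing x v y) \<le> C * hnorm (fib B x) v" if v: "v \<in> hcar (fib B x)" and y: "y \<in> space Y" for v y
  proof (cases "y \<in> core \<and> p y = x")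
    case True
    have c: "\<eta> y \<in> hcar (fib B x)" using closed_at[OF y] True by simp
    have "hnorm (fib B x) (\<eta> y) \<le> C"
      using H.hnorm_le_dist[OF c c0] core_bounded[of y y0] True y0 by (simp add: C_def)
    then have "hnorm (fib B x) v * hnorm (fib B x) (\<eta> y) \<le> C * hnorm (fib B x) v"
      using H.hnorm_nonneg[OF v] mult_right_mono by (subst mult.commute) blast
    then show ?thesis using True H.cauchy_schwarz[OF v c] by (simp add: pairing_def)
  qed (use C H.hnorm_nonneg[OF v] in \<open>auto simp: pairing_def\<close>)
  then show ?thesis by blast
qed

lemma pairing_integrable:
  assumes x: "x \<in> space X" and v: "v \<in> hcar (fib B x)"
  shows "integrable (\<rho> x) (pairing x v)"
proof -
  interpret P: prob_space "\<rho> x" using x by (rule fibre_prob)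
  obtain C where C: "\<forall>v\<in>hcar (fib B x). \<forall>y\<in>space Y. cmod (pairing x v y) \<le> C * hnorm (fib B x) v"
    using pairing_bounded[OF x] by blast
  show ?thesis
    by (rule P.integrable_const_bound[of _ "C * hnorm (fib B x) v"])
      (use C v pairing_measurable[OF x v] in \<open>auto simp: space_fibre[OF x] measurable_cong_sets[OF sets_fibre[OF x] refl]\<close>)
qed

lemma pairing_add:
  assumes x: "x \<in> space X" and uv: "u \<in> hcar (fib B x)" "v \<in> hcar (fib B x)" and y: "y \<in> space Y"
  shows "pairing x (hadd (fib B x) u v) y = pairing x u y + pairing x v y"
proof (cases "y \<in> core \<and> p y = x")
  case True
  then have "\<eta> y \<in> hcar (fib B x)" using closed_at[OF y] by simp
  from separable_hilbert_space.inner_add[OF fib_hilbert[OF x] uv this] True show ?thesis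
    by (simp add: pairing_def)
qed (auto simp: pairing_def)

lemma pairing_scale:
  assumes x: "x \<in> space X" and v: "v \<in> hcar (fib B x)" and y: "y \<in> space Y"
  shows "pairing x (hscale (fib B x) a v) y = a * pairing x v y"
proof (cases "y \<in> core \<and> p y = x")
  case True
  then have "\<eta> y \<in> hcar (fib B x)" using closed_at[OF y] by simp
  from separable_hilbert_space.inner_scale[OF fib_hilbert[OF x] v this] True show ?thesis
    by (simp add: pairing_def)
qed (auto simp: pairing_def)

text \<open>The linear functional that a weak mean of \<eta> over the core must represent. The
  variable stands in the linear slot of the inner product, hence the mean will appear in the second
  one.\<close>

definition mean_functional :: "'x \<Rightarrow> 'h \<Rightarrow> complex" where
  "mean_functional x v = (\<integral>y. pairing x v y \<partial>(\<rho> x)) / complex_of_real (measure (\<rho> x) core)"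

text \<open>The choice is harmless: a vector with these inner products is unique by
  \<open>inner_ext\<close>, and measurability and equivariance are derived from the inner products
  alone.\<close>

definition core_mean :: "'x \<Rightarrow> 'h" where
  "core_mean x = (SOME w. w \<in> hcar (fib B x) \<and> (\<forall>u\<in>hcar (fib B x). mean_functional x u = hinner (fib B x) u w))"

lemma core_mean:
  assumes x: "x \<in> space X"
  shows "core_mean x \<in> hcar (fib B x)"
    and "u \<in> hcar (fib B x) \<Longrightarrow> hinner (fib B x) u (core_mean x) = mean_functional x u"
proof -
  interpret P: prob_space "\<rho> x" using x by (rule fibre_prob)
  interpret H: separable_hilbert_space "fib B x" using x by (rule fib_hilbert)
  obtain C where C: "\<And>v y. v \<in> hcar (fib B x) \<Longrightarrow> y \<in> space Y \<Longrightarrow> cmod (pairing x v y) \<le> C * hnorm (fib B x) v"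
    using pairing_bounded[OF x] by blast
  define m where "m = measure (\<rho> x) core"
  have m: "m > 0" using measure_core_pos[OF x] by (simp add: m_def)
  have "\<exists>w\<in>hcar (fib B x). \<forall>u\<in>hcar (fib B x). mean_functional x u = hinner (fib B x) u w"
  proof (rule H.riesz_representation[where C = "C / m"])
    fix u v assume uv: "u \<in> hcar (fib B x)" "v \<in> hcar (fib B x)"
    have "(\<integral>y. pairing x (hadd (fib B x) u v) y \<partial>(\<rho> x)) = (\<integral>y. pairing x u y + pairing x v y \<partial>(\<rho> x))"
      by (intro Bochner_Integration.integral_cong refl pairing_add[OF x uv]) (simp add: space_fibre[OF x])
    then show "mean_functional x (hadd (fib B x) u v) = mean_functional x u + mean_functional x v"
      by (simp add: mean_functional_def pairing_integrable x uv add_divide_distrib)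
  next
    fix a v assume v: "v \<in> hcar (fib B x)"
    have "(\<integral>y. pairing x (hscale (fib B x) a v) y \<partial>(\<rho> x)) = (\<integral>y. a * pairing x v y \<partial>(\<rho> x))"
      by (intro Bochner_Integration.integral_cong refl pairing_scale[OF x v]) (simp add: space_fibre[OF x])
    then show "mean_functional x (hscale (fib B x) a v) = a * mean_functional x v"
      by (simp add: mean_functional_def)
  next
    fix v assume v: "v \<in> hcar (fib B x)"
    have "cmod (\<integral>y. pairing x v y \<partial>(\<rho> x)) \<le> (\<integral>y. cmod (pairing x v y) \<partial>(\<rho> x))"
      by (rule integral_norm_bound)
    also have "\<dots> \<le> (\<integral>y. C * hnorm (fib B x) v \<partial>(\<rho> x))"
      using C[OF v] by (intro integral_mono integrable_norm pairing_integrable x v) (auto simp: space_fibre[OF x])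
    finally have "cmod (\<integral>y. pairing x v y \<partial>(\<rho> x)) \<le> C * hnorm (fib B x) v" by (simp add: P.prob_space)
    then show "cmod (mean_functional x v) \<le> C / m * hnorm (fib B x) v"
      using m by (simp add: mean_functional_def m_def[symmetric] norm_divide divide_right_mono)
  qed
  then have "core_mean x \<in> hcar (fib B x) \<and>
      (\<forall>u\<in>hcar (fib B x). mean_functional x u = hinner (fib B x) u (core_mean x))"
    unfolding core_mean_def Bex_def by (rule someI_ex)
  then show "core_mean x \<in> hcar (fib B x)"
    and "u \<in> hcar (fib B x) \<Longrightarrow> hinner (fib B x) u (core_mean x) = mean_functional x u"
    by auto
qed

text \<open>Tested against a Borel section, the mean becomes a quotient of two kernel integrals. The
  conjugate appears because sections are tested with \<open>core_mean\<close> in the first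
  slot.\<close>

lemma core_mean_section: "core_mean \<in> sections B"
proof (rule sectionI)
  show "core_mean x \<in> hcar (fib B x)" if "x \<in> space X" for x using that by (rule core_mean)
  fix \<xi> assume \<xi>: "\<xi> \<in> sections B"
  \<comment> \<open>A single function on \<open>Y\<close> that replaces the family
    \<open>pairing x (\<xi> x)\<close>: the two agree almost everywhere for each \<rho>-measure, and
    the kernel applies to \<open>h\<close>.\<close>
  define h where "h y = (if y \<in> core then hinner (fib B (p y)) (\<xi> (p y)) (\<eta> y) else 0)" for y
  have [measurable]: "(\<lambda>y. hinner (fib B (p y)) (\<xi> (p y)) (\<eta> y)) \<in> borel_measurable Y"
    by (rule pullback_inner_measurable[OF p_measurable section_comp[OF p_measurable \<xi>] \<eta>])
  have h [measurable]: "h \<in> borel_measurable Y" unfolding h_def by measurable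
  have [measurable]: "(\<lambda>x. \<integral>y. h y \<partial>(\<rho> x)) \<in> borel_measurable X"
    by (rule measurable_compose[OF kernel integral_measurable_subprob_algebra[OF h]])
  have "(\<lambda>x. cnj ((\<integral>y. h y \<partial>(\<rho> x)) / complex_of_real (measure (\<rho> x) core))) \<in> borel_measurable X"
    by (rule measurable_compose[OF _ borel_measurable_continuous_onI[OF continuous_on_cnj[OF continuous_on_id]]]) measurable
  moreover have "hinner (fib B x) (core_mean x) (\<xi> x)
      = cnj ((\<integral>y. h y \<partial>(\<rho> x)) / complex_of_real (measure (\<rho> x) core))" if x: "x \<in> space X" for x
  proof -
    note s = section_closed[OF \<xi> x]
    have "(\<integral>y. h y \<partial>(\<rho> x)) = (\<integral>y. pairing x (\<xi> x) y \<partial>(\<rho> x))"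
    proof (rule integral_cong_AE)
      show "AE y in \<rho> x. h y = pairing x (\<xi> x) y"
        using AE_fibre[OF x] by eventually_elim (auto simp: h_def pairing_def)
    qed (simp_all add: measurable_cong_sets[OF sets_fibre[OF x] refl] h pairing_measurable x s)
    then show ?thesis
      using core_mean[OF x] s separable_hilbert_space.inner_commute[OF fib_hilbert[OF x] s, of "core_mean x"]
      by (simp add: mean_functional_def)
  qed
  ultimately show "(\<lambda>x. hinner (fib B x) (core_mean x) (\<xi> x)) \<in> borel_measurable X"
    by (simp cong: measurable_cong)
qed

text \<open>The affine isometry goes from the fibre over \<open>x'\<close> to that over
  \<open>x\<close>, while \<tau> moves points of \<open>Y\<close> the other way. By
  \<open>distr\<close> and \<open>ae\<close> it carries the image of \<open>\<rho> x'\<close> under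
  \<eta> to the image of \<open>\<rho> x\<close>. Ball masses, radius and core are determined by
  distances and masses, so they correspond, and a mean commutes with affine maps.\<close>

theorem core_mean_equivariant:
  assumes x: "x \<in> space X" and x': "x' \<in> space X"
    and T: "hilbert_iso (fib B x') (fib B x) T" and \<beta>: "\<beta> \<in> hcar (fib B x)"
    and \<tau> [measurable]: "\<tau> \<in> measurable Y Y" and distr: "distr (\<rho> x) Y \<tau> = \<rho> x'"
    and ae: "AE y in \<rho> x. \<eta> y = hadd (fib B x) \<beta> (T (\<eta> (\<tau> y)))"
  shows "core_mean x = hadd (fib B x) \<beta> (T (core_mean x'))"
proof -
  interpret H: separable_hilbert_space "fib B x" using x by (rule fib_hilbert)
  interpret H': separable_hilbert_space "fib B x'" using x' by (rule fib_hilbert)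
  have T_closed: "T v \<in> hcar (fib B x)" if "v \<in> hcar (fib B x')" for v
    using T that by (auto simp: hilbert_iso_def bij_betw_def)
  have T_inner: "hinner (fib B x) (T v) (T w) = hinner (fib B x') v w"
    if "v \<in> hcar (fib B x')" "w \<in> hcar (fib B x')" for v w
    using T that by (simp add: hilbert_iso_def)
  have isometry: "hdist (fib B x) (hadd (fib B x) \<beta> (T v)) (hadd (fib B x) \<beta> (T w)) = hdist (fib B x') v w"
    if "v \<in> hcar (fib B x')" "w \<in> hcar (fib B x')" for v w
    using that \<beta> T_closed[OF that(1)] T_closed[OF that(2)]
    by (simp add: hdist_def H.inner_simps H.closed H'.inner_simps H'.closed T_inner)
  have \<tau>': "\<tau> \<in> measurable (\<rho> x) Y"
    by (simp add: measurable_cong_sets[OF sets_fibre[OF x] refl] \<tau>)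
  have push: "measure (\<rho> x') A = measure (\<rho> x) (\<tau> -` A \<inter> space Y)" if "A \<in> sets Y" for A
    using measure_distr[OF \<tau>' that] distr space_fibre[OF x] by simp
  have "AE y in distr (\<rho> x) Y \<tau>. p y = x'"
    unfolding distr by (rule AE_fibre[OF x'])
  then have "AE y in \<rho> x. p (\<tau> y) = x'" by (rule AE_distrD[OF \<tau>'])
  with AE_fibre[OF x] ae AE_space
  have good: "AE y in \<rho> x. y \<in> space Y \<and> p y = x \<and> p (\<tau> y) = x' \<and> \<eta> y = hadd (fib B x) \<beta> (T (\<eta> (\<tau> y)))"
    by eventually_elim (simp add: space_fibre[OF x])
  have \<tau>_space: "\<tau> y \<in> space Y" if "y \<in> space Y" for y using that by (rule measurable_space[OF \<tau>])
  \<comment> \<open>Isometries carry balls to balls: the ball around \<open>y\<close> is, up to a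
    null set, the preimage under \<tau> of the ball around \<open>\<tau> y\<close>, whose mass
    \<open>push\<close> computes.\<close>
  have near_eq: "measure (\<rho> (p y)) (near r y) = measure (\<rho> (p (\<tau> y))) (near r (\<tau> y))"
    if y: "y \<in> space Y" "p y = x" "p (\<tau> y) = x'" "\<eta> y = hadd (fib B x) \<beta> (T (\<eta> (\<tau> y)))" for y r
  proof -
    have "AE z in \<rho> x. z \<in> near r y \<longleftrightarrow> z \<in> \<tau> -` near r (\<tau> y) \<inter> space Y"
      using good
    proof eventually_elim
      fix z assume z: "z \<in> space Y \<and> p z = x \<and> p (\<tau> z) = x' \<and> \<eta> z = hadd (fib B x) \<beta> (T (\<eta> (\<tau> z)))"
      have "\<eta> (\<tau> y) \<in> hcar (fib B x')" "\<eta> (\<tau> z) \<in> hcar (fib B x')"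
        using closed_at[OF \<tau>_space[OF y(1)]] closed_at[OF \<tau>_space, of z] y z by auto
      then have "hdist (fib B x) (\<eta> y) (\<eta> z) = hdist (fib B x') (\<eta> (\<tau> y)) (\<eta> (\<tau> z))"
        using isometry[of "\<eta> (\<tau> y)" "\<eta> (\<tau> z)"] y z by simp
      then show "z \<in> near r y \<longleftrightarrow> z \<in> \<tau> -` near r (\<tau> y) \<inter> space Y"
        using y z \<tau>_space[of z] by (simp add: near_def)
    qed
    then have "measure (\<rho> x) (near r y) = measure (\<rho> x) (\<tau> -` near r (\<tau> y) \<inter> space Y)"
      by (rule measure_eq_AE)
        (use y \<tau>_space in \<open>auto simp: sets_fibre[OF x] near_sets intro: measurable_sets[OF \<tau>]\<close>)
    then show ?thesis using push[OF near_sets[OF \<tau>_space[OF y(1)]]] y by simp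
  qed
  have conc: "AE y in \<rho> x. y \<in> concentrated r \<longleftrightarrow> \<tau> y \<in> concentrated r" for r
    using good by eventually_elim (auto simp: concentrated_def near_eq \<tau>_space)
  have "measure (\<rho> x) (concentrated r) = measure (\<rho> x') (concentrated r)" for r
  proof -
    have "measure (\<rho> x) (concentrated r) = measure (\<rho> x) (\<tau> -` concentrated r \<inter> space Y)"
      using conc[of r] AE_space
      by (intro measure_eq_AE) (auto simp: sets_fibre[OF x] space_fibre[OF x] intro: measurable_sets[OF \<tau>])
    then show ?thesis by (simp add: push)
  qed
  then have radius: "radius x = radius x'" and mass: "measure (\<rho> x) core = measure (\<rho> x') core"
    using measure_core[OF x] measure_core[OF x'] by (simp_all add: radius_def)
  have core: "AE y in \<rho> x. y \<in> core \<longleftrightarrow> \<tau> y \<in> core"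
    using good conc[of "real (radius x)"]
    by eventually_elim (simp add: core_fibre \<tau>_space radius)
  define m where "m = complex_of_real (measure (\<rho> x) core)"
  have m: "m \<noteq> 0" using measure_core_pos[OF x] by (simp add: m_def)
  note cm = core_mean(1)[OF x] core_mean(1)[OF x']
  show ?thesis
  proof (rule H.inner_ext)
    show "core_mean x \<in> hcar (fib B x)" "hadd (fib B x) \<beta> (T (core_mean x')) \<in> hcar (fib B x)"
      by (simp_all add: cm \<beta> T_closed H.closed)
    fix u assume u: "u \<in> hcar (fib B x)"
    \<comment> \<open>Surjectivity of \<open>T\<close> allows testing against \<open>T u'\<close>
      only, where the isometry removes \<open>T\<close> from the inner product.\<close>
    obtain u' where u': "u' \<in> hcar (fib B x')" "u = T u'"
      using bij_betw_imp_surj_on[of T] T u unfolding hilbert_iso_def by blast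
    note meas = measurable_cong_sets[OF sets_fibre[OF x] refl]
    \<comment> \<open>On the core the translation part contributes a constant, which integrates to
      the mass of the core; dividing by this mass, common to \<open>x\<close> and \<open>x'\<close>,
      leaves exactly the translation by \<beta>.\<close>
    have "(\<integral>y. pairing x u y \<partial>(\<rho> x))
        = (\<integral>y. indicator core y *\<^sub>R hinner (fib B x) u \<beta> + pairing x' u' (\<tau> y) \<partial>(\<rho> x))"
    proof (rule integral_cong_AE)
      show "AE y in \<rho> x. pairing x u y = indicator core y *\<^sub>R hinner (fib B x) u \<beta> + pairing x' u' (\<tau> y)"
        using good core
      proof eventually_elim
        fix y assume y: "y \<in> space Y \<and> p y = x \<and> p (\<tau> y) = x' \<and> \<eta> y = hadd (fib B x) \<beta> (T (\<eta> (\<tau> y)))"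
          and c: "y \<in> core \<longleftrightarrow> \<tau> y \<in> core"
        have "\<eta> (\<tau> y) \<in> hcar (fib B x')" using closed_at[OF \<tau>_space, of y] y by auto
        then have "hinner (fib B x) u (\<eta> y) = hinner (fib B x) u \<beta> + hinner (fib B x') u' (\<eta> (\<tau> y))"
          using y u u' \<beta> by (simp add: H.inner_add_right T_closed T_inner)
        then show "pairing x u y = indicator core y *\<^sub>R hinner (fib B x) u \<beta> + pairing x' u' (\<tau> y)"
          using y c by (simp add: pairing_def)
      qed
    qed (use pairing_measurable[OF x u] measurable_compose[OF \<tau> pairing_measurable[OF x' u'(1)]]
        in \<open>simp_all add: meas\<close>)
    also have "\<dots> = (\<integral>y. indicator core y *\<^sub>R hinner (fib B x) u \<beta> \<partial>(\<rho> x)) + (\<integral>y. pairing x' u' (\<tau> y) \<partial>(\<rho> x))"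
    proof (rule Bochner_Integration.integral_add)
      interpret P: prob_space "\<rho> x" using x by (rule fibre_prob)
      show "integrable (\<rho> x) (\<lambda>y. indicator core y *\<^sub>R hinner (fib B x) u \<beta>)"
        by (intro integrable_scaleR_left integrable_real_indicator) (auto simp: sets_fibre[OF x] P.emeasure_eq_measure)
      show "integrable (\<rho> x) (\<lambda>y. pairing x' u' (\<tau> y))"
        using pairing_integrable[OF x' u'(1)] integrable_distr_eq[OF \<tau>' pairing_measurable[OF x' u'(1)]]
        by (simp add: distr)
    qed
    also have "(\<integral>y. indicator core y *\<^sub>R hinner (fib B x) u \<beta> \<partial>(\<rho> x)) = hinner (fib B x) u \<beta> * m"
      by (simp add: m_def sets_fibre[OF x] scaleR_conv_of_real)
    also have "(\<integral>y. pairing x' u' (\<tau> y) \<partial>(\<rho> x)) = (\<integral>y. pairing x' u' y \<partial>(\<rho> x'))"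
      using integral_distr[OF \<tau>' pairing_measurable[OF x' u'(1)]] by (simp add: distr)
    finally have "mean_functional x u = hinner (fib B x) u \<beta> + mean_functional x' u'"
      using m by (simp add: mean_functional_def m_def mass field_simps)
    then have "hinner (fib B x) u (core_mean x) = hinner (fib B x) u (hadd (fib B x) \<beta> (T (core_mean x')))"
      using core_mean(2)[OF x u] core_mean(2)[OF x' u'(1)] u u' \<beta> cm
      by (simp add: H.inner_add_right T_closed T_inner)
    then show "hinner (fib B x) (core_mean x) u = hinner (fib B x) (hadd (fib B x) \<beta> (T (core_mean x'))) u"
      using H.inner_commute[OF u] cm \<beta> T_closed by (simp add: H.closed)
  qed
qed

end


section \<open>The measure of a semi-direct groupoid\<close>

context borel_haar_groupoid
begin

definition weight :: "'g \<Rightarrow> real" where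
  "weight = (SOME f. f \<in> borel_measurable (arr G) \<and> (\<forall>g\<in>space (arr G). f g > 0) \<and>
     (\<forall>u\<in>space (obj G). (\<integral>\<^sup>+ g. ennreal (f g) \<partial>(haar G u)) = 1))"

lemma weight:
  "weight \<in> borel_measurable (arr G) \<and> (\<forall>g\<in>space (arr G). weight g > 0) \<and>
    (\<forall>u\<in>space (obj G). (\<integral>\<^sup>+ g. ennreal (weight g) \<partial>(haar G u)) = 1)"
  unfolding weight_def by (rule someI_ex[OF haar_proper])

lemma weight_measurable [measurable]: "weight \<in> borel_measurable (arr G)"
  using weight by blast

lemma weight_pos: "g \<in> space (arr G) \<Longrightarrow> 0 < weight g"
  using weight by blast

lemma nn_integral_weight: "u \<in> space (obj G) \<Longrightarrow> (\<integral>\<^sup>+ g. ennreal (weight g) \<partial>(haar G u)) = 1"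
  using weight by blast

text \<open>An equivalent probability measure: strict positivity of the weight preserves null sets,
  so almost-everywhere statements can be treated in a finite setting, where kernels and Fubini's
  theorem are available.\<close>

definition haar_prob :: "'u \<Rightarrow> 'g measure" where
  "haar_prob u = density (haar G u) (\<lambda>g. ennreal (weight g))"

lemma sets_haar: "u \<in> space (obj G) \<Longrightarrow> sets (haar G u) = sets (arr G)"
  using haar_system by (simp add: borel_system_def)

lemma space_haar: "u \<in> space (obj G) \<Longrightarrow> space (haar G u) = space (arr G)"
  using sets_eq_imp_space_eq[OF sets_haar] .

lemma weight_measurable_haar: "u \<in> space (obj G) \<Longrightarrow> weight \<in> borel_measurable (haar G u)"
  using weight_measurable measurable_cong_sets[OF sets_haar refl] by blast

lemma sets_haar_prob: "u \<in> space (obj G) \<Longrightarrow> sets (haar_prob u) = sets (arr G)"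
  by (simp add: haar_prob_def sets_haar)

lemma prob_space_haar_prob: "u \<in> space (obj G) \<Longrightarrow> prob_space (haar_prob u)"
proof (rule prob_spaceI)
  assume u: "u \<in> space (obj G)"
  have "emeasure (haar_prob u) (space (haar_prob u)) = (\<integral>\<^sup>+ g. ennreal (weight g) \<partial>(haar G u))"
    unfolding haar_prob_def using weight_measurable_haar[OF u]
    by (simp add: emeasure_density indicator_def cong: nn_integral_cong)
  then show "emeasure (haar_prob u) (space (haar_prob u)) = 1" using nn_integral_weight[OF u] by simp
qed

lemma AE_haar_prob:
  assumes u: "u \<in> space (obj G)"
  shows "(AE g in haar_prob u. P g) \<longleftrightarrow> (AE g in haar G u. P g)"
proof -
  have "(AE g in haar_prob u. P g) \<longleftrightarrow> (AE g in haar G u. 0 < ennreal (weight g) \<longrightarrow> P g)"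
    unfolding haar_prob_def using weight_measurable_haar[OF u] by (intro AE_density) simp
  also have "\<dots> \<longleftrightarrow> (AE g in haar G u. P g)"
    using weight_pos by (intro AE_cong) (simp add: space_haar[OF u])
  finally show ?thesis .
qed

lemma haar_prob_kernel [measurable]: "haar_prob \<in> measurable (obj G) (subprob_algebra (arr G))"
proof (rule measurable_subprob_algebra)
  show "subprob_space (haar_prob u)" if "u \<in> space (obj G)" for u
    using prob_space_haar_prob[OF that] by (rule prob_space_imp_subprob_space)
  show "sets (haar_prob u) = sets (arr G)" if "u \<in> space (obj G)" for u
    using that by (rule sets_haar_prob)
  fix A assume A: "A \<in> sets (arr G)"
  have "(\<lambda>g. ennreal (weight g) * indicator A g) \<in> borel_measurable (arr G)"
    using A by measurable
  then have "(\<lambda>u. \<integral>\<^sup>+ g. ennreal (weight g) * indicator A g \<partial>(haar G u)) \<in> borel_measurable (obj G)"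
    using haar_system by (simp add: borel_system_def)
  moreover have "(\<integral>\<^sup>+ g. ennreal (weight g) * indicator A g \<partial>(haar G u)) = emeasure (haar_prob u) A"
    if "u \<in> space (obj G)" for u
    unfolding haar_prob_def using A weight_measurable_haar[OF that]
    by (subst emeasure_density) (simp_all add: sets_haar[OF that])
  ultimately show "(\<lambda>u. emeasure (haar_prob u) A) \<in> borel_measurable (obj G)"
    by (simp cong: measurable_cong)
qed

lemma haar_eq_density:
  assumes u: "u \<in> space (obj G)"
  shows "haar G u = density (haar_prob u) (\<lambda>g. ennreal (1 / weight g))"
proof -
  note weight_measurable_haar[OF u, measurable]
  have "density (haar_prob u) (\<lambda>g. ennreal (1 / weight g))
      = density (haar G u) (\<lambda>g. ennreal (weight g) * ennreal (1 / weight g))"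
    unfolding haar_prob_def by (rule density_density_eq) measurable
  also have "\<dots> = density (haar G u) (\<lambda>_. 1)"
    using weight_pos by (intro density_cong)
      (auto simp: space_haar[OF u] ennreal_mult[symmetric] less_imp_le less_imp_neq[symmetric])
  finally show ?thesis by (simp add: density_1)
qed

lemma sigma_finite_haar:
  assumes u: "u \<in> space (obj G)"
  shows "sigma_finite_measure (haar G u)"
proof -
  interpret P: prob_space "haar_prob u" using u by (rule prob_space_haar_prob)
  have "(\<lambda>g. ennreal (1 / weight g)) \<in> borel_measurable (arr G)" by measurable
  then have "(\<lambda>g. ennreal (1 / weight g)) \<in> borel_measurable (haar_prob u)"
    by (simp add: measurable_cong_sets[OF sets_haar_prob[OF u] refl])
  then show ?thesis
    unfolding haar_eq_density[OF u] by (simp add: P.sigma_finite_iff_density_finite)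
qed

text \<open>Haar measures may be infinite and then form no subprobability kernel; the mass is
  therefore recovered by integrating the inverse weight against \<open>haar_prob\<close>.\<close>

lemma haar_section_measurable:
  assumes a: "a \<in> measurable M (obj G)" and A: "A \<in> sets (M \<Otimes>\<^sub>M arr G)"
  shows "(\<lambda>x. emeasure (haar G (a x)) (Pair x -` A)) \<in> borel_measurable M"
proof -
  note a[measurable] A[measurable]
  have "(\<lambda>x. \<integral>\<^sup>+ g. ennreal (1 / weight g) * indicator A (x, g) \<partial>haar_prob (a x)) \<in> borel_measurable M"
    by (rule nn_integral_measurable_subprob_algebra2) measurable
  moreover have "(\<integral>\<^sup>+ g. ennreal (1 / weight g) * indicator A (x, g) \<partial>haar_prob (a x))
      = emeasure (haar G (a x)) (Pair x -` A)" if x: "x \<in> space M" for x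
  proof -
    have u: "a x \<in> space (obj G)" using measurable_space[OF a x] .
    have "(\<lambda>g. ennreal (1 / weight g)) \<in> borel_measurable (haar_prob (a x))"
      unfolding measurable_cong_sets[OF sets_haar_prob[OF u] refl] by measurable
    then show ?thesis
      using sets_Pair1[OF A, of x]
      by (subst haar_eq_density[OF u]) (simp add: emeasure_density sets_haar_prob[OF u] indicator_def vimage_def)
  qed
  ultimately show ?thesis by (simp cong: measurable_cong)
qed

end

section \<open>Null sets of the semi-direct groupoid\<close>

locale haar_gspace = borel_haar_groupoid G + gspace G X
  for G :: "('g, 'u, 'm) haar_groupoid_scheme" and X :: "('g, 'u, 'x, 'n) gspace_scheme" +
  fixes \<mu> :: "'x measure"
  assumes sets_base: "sets \<mu> = sets (pts X)"
begin

abbreviation \<Gamma> :: "('x \<times> 'g, 'x) measured_groupoid" where "\<Gamma> \<equiv> semidirect G X \<mu>"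

lemma semidirect_sel:
  "arr \<Gamma> = restrict_space (pts X \<Otimes>\<^sub>M arr G) {(x, g). anc X x = rng G g}"
  "obj \<Gamma> = pts X" "umeas \<Gamma> = \<mu>" "rng \<Gamma> = fst" "src \<Gamma> = (\<lambda>w. act X (ivs G (snd w)) (fst w))"
  "mlt \<Gamma> w w' = (fst w, mlt G (snd w) (snd w'))"
  "haar \<Gamma> x = restrict_space (return (pts X) x \<Otimes>\<^sub>M haar G (anc X x)) {(x, g). anc X x = rng G g}"
  by (auto simp: semidirect_def fun_eq_iff split_beta)

lemma anc_space: "x \<in> space (pts X) \<Longrightarrow> anc X x \<in> space (obj G)"
  using measurable_space[OF anc_borel] .

lemma space_arr: "space (arr \<Gamma>) = {(x, g). x \<in> space (pts X) \<and> g \<in> space (arr G) \<and> anc X x = rng G g}"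
  by (auto simp: semidirect_sel space_restrict_space space_pair_measure)

lemma arrows_sets: "{(x, g). anc X x = rng G g} \<inter> space (pts X \<Otimes>\<^sub>M arr G) \<in> sets (pts X \<Otimes>\<^sub>M arr G)"
proof -
  have "{w \<in> space (pts X \<Otimes>\<^sub>M arr G). anc X (fst w) = rng G (snd w)} \<in> sets (pts X \<Otimes>\<^sub>M arr G)"
    by (rule standard_borel_diagonal[OF standard_obj])
      (rule measurable_compose[OF measurable_fst anc_borel] measurable_compose[OF measurable_snd rng_borel])+
  also have "{w \<in> space (pts X \<Otimes>\<^sub>M arr G). anc X (fst w) = rng G (snd w)}
      = {(x, g). anc X x = rng G g} \<inter> space (pts X \<Otimes>\<^sub>M arr G)"
    by auto
  finally show ?thesis .
qed

lemma sets_arr_iff: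
  "A \<in> sets (arr \<Gamma>) \<longleftrightarrow> A \<subseteq> {(x, g). anc X x = rng G g} \<and> A \<in> sets (pts X \<Otimes>\<^sub>M arr G)"
  unfolding semidirect_sel by (rule sets_restrict_space_iff[OF arrows_sets])

lemma src_space: "w \<in> space (arr \<Gamma>) \<Longrightarrow> src \<Gamma> w \<in> space (pts X)"
  unfolding space_arr by (auto simp: semidirect_sel(5) src_ivs intro!: act_closed ivs_closed)

lemma rng_measurable: "rng \<Gamma> \<in> measurable (arr \<Gamma>) (pts X)"
  by (simp add: semidirect_sel measurable_restrict_space1)

lemma sets_haar_semidirect: "x \<in> space (pts X) \<Longrightarrow> sets (haar \<Gamma> x) = sets (arr \<Gamma>)"
  unfolding semidirect_sel
  by (intro sets_restrict_space_cong sets_pair_measure_cong) (simp_all add: sets_haar anc_space)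

text \<open>Integrating out the Dirac factor; sigma-finiteness of the Haar measure justifies
  computing the product measure by sections.\<close>

lemma emeasure_haar_semidirect:
  assumes x: "x \<in> space (pts X)" and A: "A \<in> sets (arr \<Gamma>)"
  shows "emeasure (haar \<Gamma> x) A = emeasure (haar G (anc X x)) (Pair x -` A)"
proof -
  interpret H: sigma_finite_measure "haar G (anc X x)"
    using sigma_finite_haar[OF anc_space[OF x]] .
  let ?M = "return (pts X) x \<Otimes>\<^sub>M haar G (anc X x)"
  have sets: "sets ?M = sets (pts X \<Otimes>\<^sub>M arr G)"
    by (intro sets_pair_measure_cong) (simp_all add: sets_haar anc_space x)
  have A': "A \<in> sets ?M" "A \<subseteq> {(x, g). anc X x = rng G g}" using A unfolding sets sets_arr_iff by blast+
  have "emeasure (haar \<Gamma> x) A = emeasure ?M A"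
    unfolding semidirect_sel
  proof (rule emeasure_restrict_space)
    show "{(x, g). anc X x = rng G g} \<inter> space ?M \<in> sets ?M"
      unfolding sets sets_eq_imp_space_eq[OF sets] by (rule arrows_sets)
  qed (rule A')
  also have "\<dots> = (\<integral>\<^sup>+ x'. emeasure (haar G (anc X x)) (Pair x' -` A) \<partial>return (pts X) x)"
    by (rule H.emeasure_pair_measure_alt[OF A'(1)])
  also have "\<dots> = emeasure (haar G (anc X x)) (Pair x -` A)"
    using H.measurable_emeasure_Pair[OF A'(1)] by (intro nn_integral_return x) simp
  finally show ?thesis .
qed

text \<open>\<open>arr_meas\<close> is built with \<open>measure_of\<close>, which returns the
  prescribed set function only once countable additivity is checked; this rests on exchanging the
  sum with the integral over \<mu>.\<close>

lemma emeasure_arr_meas: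
  assumes A: "A \<in> sets (arr \<Gamma>)"
  shows "emeasure (arr_meas \<Gamma>) A = (\<integral>\<^sup>+ x. emeasure (haar G (anc X x)) (Pair x -` A) \<partial>\<mu>)"
proof -
  let ?m = "\<lambda>A. \<integral>\<^sup>+ x. emeasure (haar \<Gamma> x) A \<partial>\<mu>"
  have space: "space \<mu> = space (pts X)" using sets_base by (rule sets_eq_imp_space_eq)
  have meas: "(\<lambda>x. emeasure (haar \<Gamma> x) A) \<in> borel_measurable \<mu>" if A: "A \<in> sets (arr \<Gamma>)" for A
  proof -
    have "(\<lambda>x. emeasure (haar G (anc X x)) (Pair x -` A)) \<in> borel_measurable (pts X)"
      using A by (intro haar_section_measurable anc_borel) (simp add: sets_arr_iff)
    also have "?this \<longleftrightarrow> (\<lambda>x. emeasure (haar \<Gamma> x) A) \<in> borel_measurable (pts X)"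
      by (rule measurable_cong) (simp add: emeasure_haar_semidirect A)
    finally show ?thesis by (simp add: measurable_cong_sets[OF sets_base refl])
  qed
  have "emeasure (measure_of (space (arr \<Gamma>)) (sets (arr \<Gamma>)) ?m) A = ?m A"
  proof (rule emeasure_measure_of_sigma)
    show "positive (sets (arr \<Gamma>)) ?m" by (simp add: positive_def)
    show "countably_additive (sets (arr \<Gamma>)) ?m"
    proof (rule countably_additiveI)
      fix F :: "nat \<Rightarrow> ('x \<times> 'g) set"
      assume F: "range F \<subseteq> sets (arr \<Gamma>)" "disjoint_family F"
      have "(\<Sum>i. ?m (F i)) = (\<integral>\<^sup>+ x. (\<Sum>i. emeasure (haar \<Gamma> x) (F i)) \<partial>\<mu>)"
        using F by (intro nn_integral_suminf[symmetric] meas) auto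
      also have "\<dots> = ?m (\<Union>i. F i)"
        using F by (intro nn_integral_cong suminf_emeasure) (auto simp: space sets_haar_semidirect)
      finally show "(\<Sum>i. ?m (F i)) = ?m (\<Union>i. F i)" .
    qed
  qed (use A sets.sigma_algebra_axioms in auto)
  also have "?m A = (\<integral>\<^sup>+ x. emeasure (haar G (anc X x)) (Pair x -` A) \<partial>\<mu>)"
    by (intro nn_integral_cong emeasure_haar_semidirect A) (simp add: space)
  finally show ?thesis by (simp add: arr_meas_def semidirect_sel(3))
qed

lemma space_arr_meas: "space (arr_meas \<Gamma>) = space (arr \<Gamma>)"
  and sets_arr_meas: "sets (arr_meas \<Gamma>) = sets (arr \<Gamma>)"
  by (simp_all add: arr_meas_def)

lemma null_arr_meas_iff:
  assumes A: "A \<in> sets (arr \<Gamma>)"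
  shows "A \<in> null_sets (arr_meas \<Gamma>) \<longleftrightarrow> (AE x in \<mu>. AE g in haar G (anc X x). (x, g) \<notin> A)"
proof -
  have space: "space \<mu> = space (pts X)" using sets_base by (rule sets_eq_imp_space_eq)
  have A': "A \<in> sets (pts X \<Otimes>\<^sub>M arr G)" using A by (simp add: sets_arr_iff)
  have "A \<in> null_sets (arr_meas \<Gamma>) \<longleftrightarrow> (\<integral>\<^sup>+ x. emeasure (haar G (anc X x)) (Pair x -` A) \<partial>\<mu>) = 0"
    using A by (simp add: null_sets_def emeasure_arr_meas) (simp add: arr_meas_def)
  also have "\<dots> \<longleftrightarrow> (AE x in \<mu>. emeasure (haar G (anc X x)) (Pair x -` A) = 0)"
    using haar_section_measurable[OF anc_borel A']
    by (intro nn_integral_0_iff_AE) (simp add: measurable_cong_sets[OF sets_base refl])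
  also have "\<dots> \<longleftrightarrow> (AE x in \<mu>. AE g in haar G (anc X x). (x, g) \<notin> A)"
  proof (intro AE_cong)
    fix x assume "x \<in> space \<mu>"
    then have x: "x \<in> space (pts X)" by (simp add: space)
    have "Pair x -` A \<in> sets (haar G (anc X x))"
      using sets_Pair1[OF A'] by (simp add: sets_haar anc_space x)
    then show "emeasure (haar G (anc X x)) (Pair x -` A) = 0 \<longleftrightarrow> (AE g in haar G (anc X x). (x, g) \<notin> A)"
      using AE_iff_null_sets[of "Pair x -` A" "haar G (anc X x)"] by (auto simp: null_sets_def)
  qed
  finally show ?thesis .
qed

text \<open>The exceptional set is delivered as a Borel subset of the full product, not of the arrow
  space, so that it can be pulled back and sectioned freely.\<close>

lemma AE_arr_measD:
  assumes "AE w in arr_meas \<Gamma>. P w"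
  obtains N where "N \<in> sets (pts X \<Otimes>\<^sub>M arr G)"
    and "AE x in \<mu>. AE g in haar G (anc X x). (x, g) \<notin> N"
    and "\<And>w. w \<in> space (arr \<Gamma>) \<Longrightarrow> w \<notin> N \<Longrightarrow> P w"
proof -
  obtain N where N: "\<And>w. w \<in> space (arr_meas \<Gamma>) - N \<Longrightarrow> P w" "N \<in> null_sets (arr_meas \<Gamma>)"
    using AE_E3[OF assms] by blast
  have s: "N \<in> sets (arr \<Gamma>)" using null_setsD2[OF N(2)] unfolding sets_arr_meas .
  show thesis
  proof (rule that[of N])
    show "N \<in> sets (pts X \<Otimes>\<^sub>M arr G)" using s unfolding sets_arr_iff by (rule conjunct2)
    show "AE x in \<mu>. AE g in haar G (anc X x). (x, g) \<notin> N"
      using N(2) unfolding null_arr_meas_iff[OF s] .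
    show "P w" if "w \<in> space (arr \<Gamma>)" "w \<notin> N" for w
      using N(1)[of w] that unfolding space_arr_meas by simp
  qed
qed

lemma AE_arr_measI:
  assumes N: "N \<in> sets (pts X \<Otimes>\<^sub>M arr G)"
    and ae: "AE x in \<mu>. AE g in haar G (anc X x). (x, g) \<notin> N"
    and P: "\<And>w. w \<in> space (arr \<Gamma>) \<Longrightarrow> w \<notin> N \<Longrightarrow> P w"
  shows "AE w in arr_meas \<Gamma>. P w"
proof -
  \<comment> \<open>Cutting down to arrows makes the set measurable in the arrow space without
    affecting points at which \<open>P\<close> is claimed.\<close>
  let ?N = "N \<inter> ({(x, g). anc X x = rng G g} \<inter> space (pts X \<Otimes>\<^sub>M arr G))"
  have s: "?N \<in> sets (arr \<Gamma>)"
    unfolding sets_arr_iff using sets.Int[OF N arrows_sets] by blast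
  have "AE x in \<mu>. AE g in haar G (anc X x). (x, g) \<notin> ?N"
    using ae by (rule eventually_mono) (auto elim!: eventually_mono)
  then have "?N \<in> null_sets (arr_meas \<Gamma>)" using null_arr_meas_iff[OF s] by blast
  then show ?thesis
  proof (rule AE_I')
    show "{w \<in> space (arr_meas \<Gamma>). \<not> P w} \<subseteq> ?N"
      using P unfolding space_arr_meas by (auto simp: space_arr space_pair_measure)
  qed
qed

end


section \<open>Cohomology classes\<close>

locale bundle_cocycles = borel_hilbert_bundle "obj M" B
  for M :: "('g, 'u, 'm) measured_groupoid_scheme" and B :: "('u, 'h) hbundle" +
  fixes L :: "'g \<Rightarrow> 'h \<Rightarrow> 'h"
  assumes rng_meas: "rng M \<in> measurable (arr M) (obj M)"
    and src_in: "g \<in> space (arr M) \<Longrightarrow> src M g \<in> space (obj M)"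
    and L_iso: "g \<in> space (arr M) \<Longrightarrow> hilbert_iso (fib B (src M g)) (fib B (rng M g)) (L g)"
begin

lemma L_closed: "g \<in> space (arr M) \<Longrightarrow> v \<in> hcar (fib B (src M g)) \<Longrightarrow> L g v \<in> hcar (fib B (rng M g))"
  by (rule hilbert_iso_closed[OF L_iso])

lemma L_add:
  "\<lbrakk>g \<in> space (arr M); v \<in> hcar (fib B (src M g)); w \<in> hcar (fib B (src M g))\<rbrakk>
    \<Longrightarrow> L g (hadd (fib B (src M g)) v w) = hadd (fib B (rng M g)) (L g v) (L g w)"
  by (rule hilbert_iso_add[OF L_iso])

lemma L_scale:
  "\<lbrakk>g \<in> space (arr M); v \<in> hcar (fib B (src M g))\<rbrakk>
    \<Longrightarrow> L g (hscale (fib B (src M g)) a v) = hscale (fib B (rng M g)) a (L g v)"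
  by (rule hilbert_iso_scale[OF L_iso])

lemma rng_hilbert: "g \<in> space (arr M) \<Longrightarrow> separable_hilbert_space (fib B (rng M g))"
  using measurable_space[OF rng_meas] by (rule fib_hilbert)

lemma src_hilbert: "g \<in> space (arr M) \<Longrightarrow> separable_hilbert_space (fib B (src M g))"
  using src_in by (rule fib_hilbert)

lemma L_zero:
  assumes g: "g \<in> space (arr M)"
  shows "L g (hzero (fib B (src M g))) = hzero (fib B (rng M g))"
proof -
  interpret S: separable_hilbert_space "fib B (src M g)" using g by (rule src_hilbert)
  interpret R: separable_hilbert_space "fib B (rng M g)" using g by (rule rng_hilbert)
  show ?thesis
    using L_scale[OF g S.zero_closed, of 0]
    unfolding S.scale_zero[OF S.zero_closed] R.scale_zero[OF L_closed[OF g S.zero_closed]] .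
qed

text \<open>Makes the closure properties of pulled-back sections available for the bundle
  itself.\<close>

lemma sections_id: "sections (pullback (obj M) (\<lambda>z. z) B) = sections B"
proof (intro set_eqI iffI)
  show "\<xi> \<in> sections B" if "\<xi> \<in> sections (pullback (obj M) (\<lambda>z. z) B)" for \<xi>
    using that by (intro sectionI) (simp_all add: sections_pullback_iff)
  show "\<xi> \<in> sections (pullback (obj M) (\<lambda>z. z) B)" if "\<xi> \<in> sections B" for \<xi>
    using section_closed[OF that] section_inner_measurable[OF that] by (simp add: sections_pullback_iff)
qed

lemma section_zero: "(\<lambda>z. hzero (fib B z)) \<in> sections B"
  using pullback_zero[OF measurable_ident_sets[OF refl]] unfolding sections_id .

lemma section_add:
  "\<xi> \<in> sections B \<Longrightarrow> \<zeta> \<in> sections B \<Longrightarrow> (\<lambda>z. hadd (fib B z) (\<xi> z) (\<zeta> z)) \<in> sections B"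
  using pullback_add[OF measurable_ident_sets[OF refl], of \<xi> \<zeta>] unfolding sections_id .

lemma section_scale: "\<xi> \<in> sections B \<Longrightarrow> (\<lambda>z. hscale (fib B z) a (\<xi> z)) \<in> sections B"
  using pullback_scale[OF measurable_ident_sets[OF refl], of \<xi> a] unfolding sections_id .

lemma cocycle_closed:
  "b \<in> cocycles M B L \<Longrightarrow> g \<in> space (arr M) \<Longrightarrow> b g \<in> hcar (fib B (rng M g))"
  by (rule pullback_closed[OF rng_meas]) (simp only: cocycles_def mem_Collect_eq)

lemma AE_arrow: "AE g in arr_meas M. g \<in> space (arr M)"
  using AE_space[of "arr_meas M"] by (simp add: arr_meas_def)

lemma section_at:
  assumes "\<xi> \<in> sections B" "g \<in> space (arr M)"
  shows "\<xi> (rng M g) \<in> hcar (fib B (rng M g))" "\<xi> (src M g) \<in> hcar (fib B (src M g))"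
  using section_closed[OF assms(1)] measurable_space[OF rng_meas assms(2)] src_in[OF assms(2)] by simp_all

text \<open>The witnesses are the zero section, the negative of a given section, and the sum of two
  given sections; linearity of \<open>L\<close> on each arrow does the rest.\<close>

lemma equiv_cohomologous: "equiv (cocycles M B L) (cohomologous M B L)"
proof (rule equivI)
  show "cohomologous M B L \<subseteq> cocycles M B L \<times> cocycles M B L"
    by (auto simp: cohomologous_def)
  show "refl_on (cocycles M B L) (cohomologous M B L)"
  proof (rule refl_onI)
    fix b assume b: "b \<in> cocycles M B L"
    have "coboundary M B L (\<lambda>g. hdiff (fib B (rng M g)) (b g) (b g))"
      unfolding coboundary_def
    proof (rule bexI[OF _ section_zero])
      show "AE g in arr_meas M. hdiff (fib B (rng M g)) (b g) (b g)
          = hdiff (fib B (rng M g)) (hzero (fib B (rng M g))) (L g (hzero (fib B (src M g))))"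
        using AE_arrow
      proof eventually_elim
        fix g assume g: "g \<in> space (arr M)"
        interpret R: separable_hilbert_space "fib B (rng M g)" using g by (rule rng_hilbert)
        show "hdiff (fib B (rng M g)) (b g) (b g)
            = hdiff (fib B (rng M g)) (hzero (fib B (rng M g))) (L g (hzero (fib B (src M g))))"
          using cocycle_closed[OF b g] by (intro R.inner_ext) (simp_all add: L_zero g R.closed R.inner_simps)
      qed
    qed
    then show "(b, b) \<in> cohomologous M B L" using b by (simp add: cohomologous_def)
  qed
  show "sym (cohomologous M B L)"
  proof (rule symI)
    fix b c assume "(b, c) \<in> cohomologous M B L"
    then obtain \<xi> where bc: "b \<in> cocycles M B L" "c \<in> cocycles M B L" and \<xi>: "\<xi> \<in> sections B"
      and ae: "AE g in arr_meas M. hdiff (fib B (rng M g)) (b g) (c g)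
          = hdiff (fib B (rng M g)) (\<xi> (rng M g)) (L g (\<xi> (src M g)))"
      by (auto simp: cohomologous_def coboundary_def)
    have "coboundary M B L (\<lambda>g. hdiff (fib B (rng M g)) (c g) (b g))"
      unfolding coboundary_def
    proof (rule bexI[OF _ section_scale[OF \<xi>, of "-1"]])
      show "AE g in arr_meas M. hdiff (fib B (rng M g)) (c g) (b g)
          = hdiff (fib B (rng M g)) (hscale (fib B (rng M g)) (-1) (\<xi> (rng M g)))
              (L g (hscale (fib B (src M g)) (-1) (\<xi> (src M g))))"
        using AE_arrow ae
      proof eventually_elim
        fix g assume g: "g \<in> space (arr M)"
          and eq: "hdiff (fib B (rng M g)) (b g) (c g)
            = hdiff (fib B (rng M g)) (\<xi> (rng M g)) (L g (\<xi> (src M g)))"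
        interpret R: separable_hilbert_space "fib B (rng M g)" using g by (rule rng_hilbert)
        note cl = section_at[OF \<xi> g] L_closed[OF g section_at(2)[OF \<xi> g]]
          cocycle_closed[OF bc(1) g] cocycle_closed[OF bc(2) g]
        show "hdiff (fib B (rng M g)) (c g) (b g)
          = hdiff (fib B (rng M g)) (hscale (fib B (rng M g)) (-1) (\<xi> (rng M g)))
              (L g (hscale (fib B (src M g)) (-1) (\<xi> (src M g))))"
          unfolding L_scale[OF g cl(2)]
        proof (rule R.inner_ext)
          fix v assume v: "v \<in> hcar (fib B (rng M g))"
          have "hinner (fib B (rng M g)) (hdiff (fib B (rng M g)) (b g) (c g)) v
              = hinner (fib B (rng M g)) (hdiff (fib B (rng M g)) (\<xi> (rng M g)) (L g (\<xi> (src M g)))) v"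
            by (simp only: eq)
          then show "hinner (fib B (rng M g)) (hdiff (fib B (rng M g)) (c g) (b g)) v
              = hinner (fib B (rng M g)) (hdiff (fib B (rng M g)) (hscale (fib B (rng M g)) (-1) (\<xi> (rng M g)))
                  (hscale (fib B (rng M g)) (-1) (L g (\<xi> (src M g))))) v"
            using cl v by (simp add: R.closed R.inner_simps algebra_simps)
        qed (simp_all add: cl R.closed)
      qed
    qed
    then show "(c, b) \<in> cohomologous M B L" using bc by (simp add: cohomologous_def)
  qed
  show "trans (cohomologous M B L)"
  proof (rule transI)
    fix b c d assume "(b, c) \<in> cohomologous M B L" "(c, d) \<in> cohomologous M B L"
    then obtain \<xi> \<zeta> where bcd: "b \<in> cocycles M B L" "c \<in> cocycles M B L" "d \<in> cocycles M B L"
      and s: "\<xi> \<in> sections B" "\<zeta> \<in> sections B"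
      and ae: "AE g in arr_meas M. hdiff (fib B (rng M g)) (b g) (c g)
          = hdiff (fib B (rng M g)) (\<xi> (rng M g)) (L g (\<xi> (src M g)))"
        "AE g in arr_meas M. hdiff (fib B (rng M g)) (c g) (d g)
          = hdiff (fib B (rng M g)) (\<zeta> (rng M g)) (L g (\<zeta> (src M g)))"
      by (auto simp: cohomologous_def coboundary_def)
    have "coboundary M B L (\<lambda>g. hdiff (fib B (rng M g)) (b g) (d g))"
      unfolding coboundary_def
    proof (rule bexI[OF _ section_add[OF s]])
      show "AE g in arr_meas M. hdiff (fib B (rng M g)) (b g) (d g)
          = hdiff (fib B (rng M g)) (hadd (fib B (rng M g)) (\<xi> (rng M g)) (\<zeta> (rng M g)))
              (L g (hadd (fib B (src M g)) (\<xi> (src M g)) (\<zeta> (src M g))))"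
        using AE_arrow ae
      proof eventually_elim
        fix g assume g: "g \<in> space (arr M)"
          and eq: "hdiff (fib B (rng M g)) (b g) (c g)
            = hdiff (fib B (rng M g)) (\<xi> (rng M g)) (L g (\<xi> (src M g)))"
            "hdiff (fib B (rng M g)) (c g) (d g)
            = hdiff (fib B (rng M g)) (\<zeta> (rng M g)) (L g (\<zeta> (src M g)))"
        interpret R: separable_hilbert_space "fib B (rng M g)" using g by (rule rng_hilbert)
        note cl = section_at[OF s(1) g] section_at[OF s(2) g]
          L_closed[OF g section_at(2)[OF s(1) g]] L_closed[OF g section_at(2)[OF s(2) g]]
          cocycle_closed[OF bcd(1) g] cocycle_closed[OF bcd(2) g] cocycle_closed[OF bcd(3) g]
        show "hdiff (fib B (rng M g)) (b g) (d g)
          = hdiff (fib B (rng M g)) (hadd (fib B (rng M g)) (\<xi> (rng M g)) (\<zeta> (rng M g)))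
              (L g (hadd (fib B (src M g)) (\<xi> (src M g)) (\<zeta> (src M g))))"
          unfolding L_add[OF g cl(2) cl(4)]
        proof (rule R.inner_ext)
          fix v assume v: "v \<in> hcar (fib B (rng M g))"
          have "hinner (fib B (rng M g)) (hdiff (fib B (rng M g)) (b g) (c g)) v
              + hinner (fib B (rng M g)) (hdiff (fib B (rng M g)) (c g) (d g)) v
              = hinner (fib B (rng M g)) (hdiff (fib B (rng M g)) (\<xi> (rng M g)) (L g (\<xi> (src M g)))) v
              + hinner (fib B (rng M g)) (hdiff (fib B (rng M g)) (\<zeta> (rng M g)) (L g (\<zeta> (src M g)))) v"
            by (simp only: eq)
          then show "hinner (fib B (rng M g)) (hdiff (fib B (rng M g)) (b g) (d g)) v
              = hinner (fib B (rng M g)) (hdiff (fib B (rng M g))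
                  (hadd (fib B (rng M g)) (\<xi> (rng M g)) (\<zeta> (rng M g)))
                  (hadd (fib B (rng M g)) (L g (\<xi> (src M g))) (L g (\<zeta> (src M g))))) v"
            using cl v by (simp add: R.closed R.inner_simps algebra_simps)
        qed (simp_all add: cl R.closed)
      qed
    qed
    then show "(b, d) \<in> cohomologous M B L" using bcd by (simp add: cohomologous_def)
  qed
qed

end


section \<open>Measure preserving extensions\<close>

lemma conull_iff_AE: "conull \<mu> U \<longleftrightarrow> U \<in> sets \<mu> \<and> (AE x in \<mu>. x \<in> U)"
proof -
  have "space \<mu> - U \<in> null_sets \<mu> \<longleftrightarrow> (AE x in \<mu>. x \<in> U)" if "U \<in> sets \<mu>"
    using AE_iff_null_sets[of "space \<mu> - U" \<mu>] that AE_cong[of \<mu> "\<lambda>x. x \<notin> space \<mu> - U" "\<lambda>x. x \<in> U"] by auto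
  then show ?thesis by (auto simp: conull_def)
qed

locale measure_preserving_extension =
  Yg: haar_gspace G Y \<nu> + Xg: haar_gspace G X \<mu> +
  prob_system "pts Y" "pts X" p \<rho> + borel_hilbert_bundle "pts X" B
  for G :: "('g, 'u, 'm) haar_groupoid_scheme"
    and Y :: "('g, 'u, 'y, 'k) gspace_scheme" and \<nu> :: "'y measure"
    and X :: "('g, 'u, 'x, 'n) gspace_scheme" and \<mu> :: "'x measure"
    and p :: "'y \<Rightarrow> 'x" and \<rho> :: "'x \<Rightarrow> 'y measure" and B :: "('x, 'h) hbundle" +
  fixes L :: "'x \<times> 'g \<Rightarrow> 'h \<Rightarrow> 'h"
  assumes equivariant: "equivariant G Y X p"
    and invariant: "\<lbrakk>g \<in> space (arr G); x \<in> space (pts X); src G g = anc X x\<rbrakk> \<Longrightarrow>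
      distr (restrict_space (\<rho> x) {y \<in> space (pts Y). anc Y y = src G g}) (pts Y) (act Y g) = \<rho> (act X g x)"
    and disintegration: "A \<in> sets (pts Y) \<Longrightarrow> emeasure \<nu> A = (\<integral>\<^sup>+ x. emeasure (\<rho> x) A \<partial>\<mu>)"
    and L_iso: "w \<in> space (arr (semidirect G X \<mu>)) \<Longrightarrow>
      hilbert_iso (fib B (src (semidirect G X \<mu>) w)) (fib B (rng (semidirect G X \<mu>) w)) (L w)"
begin

abbreviation \<Gamma> where "\<Gamma> \<equiv> semidirect G X \<mu>"
abbreviation \<Delta> where "\<Delta> \<equiv> semidirect G Y \<nu>"
abbreviation \<phi> :: "'y \<times> 'g \<Rightarrow> 'x \<times> 'g" where "\<phi> \<equiv> semidirect_hom p"
abbreviation B' where "B' \<equiv> pullback (pts Y) p B"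

lemma anc_p: "y \<in> space (pts Y) \<Longrightarrow> anc X (p y) = anc Y y"
  using equivariant by (simp add: equivariant_def)

lemma act_p:
  "\<lbrakk>g \<in> space (arr G); y \<in> space (pts Y); src G g = anc Y y\<rbrakk> \<Longrightarrow> p (act Y g y) = act X g (p y)"
  using equivariant by (simp add: equivariant_def)

lemma space_base: "space \<mu> = space (pts X)" and space_ext: "space \<nu> = space (pts Y)"
  using sets_eq_imp_space_eq[OF Xg.sets_base] sets_eq_imp_space_eq[OF Yg.sets_base] .

section \<open>Null sets under disintegration\<close>

lemma null_disintegration:
  assumes A: "A \<in> sets (pts Y)"
  shows "A \<in> null_sets \<nu> \<longleftrightarrow> (AE x in \<mu>. AE y in \<rho> x. y \<notin> A)"
proof -
  have "(\<lambda>x. emeasure (\<rho> x) A) \<in> borel_measurable (pts X)"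
    by (rule measurable_compose[OF kernel measurable_emeasure_subprob_algebra[OF A]])
  then have m: "(\<lambda>x. emeasure (\<rho> x) A) \<in> borel_measurable \<mu>"
    by (simp add: measurable_cong_sets[OF Xg.sets_base refl])
  have "A \<in> null_sets \<nu> \<longleftrightarrow> (AE x in \<mu>. emeasure (\<rho> x) A = 0)"
    using A nn_integral_0_iff_AE[OF m] by (simp add: null_sets_def Yg.sets_base disintegration)
  also have "\<dots> \<longleftrightarrow> (AE x in \<mu>. AE y in \<rho> x. y \<notin> A)"
  proof (intro AE_cong)
    fix x assume "x \<in> space \<mu>"
    then have s: "A \<in> sets (\<rho> x)" using A sets_fibre by (simp add: space_base)
    then show "emeasure (\<rho> x) A = 0 \<longleftrightarrow> (AE y in \<rho> x. y \<notin> A)"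
      using AE_iff_null_sets[OF s] by (simp add: null_sets_def)
  qed
  finally show ?thesis .
qed

lemma AE_disintegrate:
  assumes "AE y in \<nu>. Q y"
  shows "AE x in \<mu>. AE y in \<rho> x. Q y"
proof -
  obtain N where N: "\<And>y. y \<in> space \<nu> - N \<Longrightarrow> Q y" "N \<in> null_sets \<nu>"
    using AE_E3[OF assms] by blast
  have "N \<in> sets (pts Y)" using null_setsD2[OF N(2)] by (simp add: Yg.sets_base)
  from null_disintegration[OF this] N(2) have "AE x in \<mu>. AE y in \<rho> x. y \<notin> N" by blast
  with AE_space show ?thesis
  proof eventually_elim
    fix x assume x: "x \<in> space \<mu>" and "AE y in \<rho> x. y \<notin> N"
    from this(2) AE_space show "AE y in \<rho> x. Q y"
      by eventually_elim (use N(1) x in \<open>simp add: space_fibre space_base space_ext\<close>)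
  qed
qed

text \<open>Since \<open>\<rho> x\<close> lives on the fibre over \<open>x\<close>, the preimage of
  a null set \<open>N\<close> is \<open>\<rho> x\<close>-null for every \<open>x\<close> outside
  \<open>N\<close>.\<close>

lemma AE_lift:
  assumes "AE x in \<mu>. P x"
  shows "AE y in \<nu>. P (p y)"
proof -
  obtain N where N: "\<And>x. x \<in> space \<mu> - N \<Longrightarrow> P x" "N \<in> null_sets \<mu>"
    using AE_E3[OF assms] by blast
  have s: "p -` N \<inter> space (pts Y) \<in> sets (pts Y)"
    using null_setsD2[OF N(2)] by (intro measurable_sets[OF p_measurable]) (simp add: Xg.sets_base)
  have "AE x in \<mu>. AE y in \<rho> x. y \<notin> p -` N \<inter> space (pts Y)"
    using AE_not_in[OF N(2)] AE_space
  proof eventually_elim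
    fix x assume x: "x \<notin> N" "x \<in> space \<mu>"
    then show "AE y in \<rho> x. y \<notin> p -` N \<inter> space (pts Y)"
      using AE_fibre[of x] by (auto simp: space_base elim: eventually_mono)
  qed
  then have "p -` N \<inter> space (pts Y) \<in> null_sets \<nu>" using null_disintegration[OF s] by blast
  from AE_not_in[OF this] AE_space show ?thesis
    by eventually_elim (use N(1) p_space in \<open>simp add: space_base space_ext\<close>)
qed

section \<open>Cocycles and coboundaries along the homomorphism\<close>

lemma hom_arrow: "w \<in> space (arr \<Delta>) \<Longrightarrow> \<phi> w \<in> space (arr \<Gamma>)"
  by (auto simp: Yg.space_arr Xg.space_arr semidirect_hom_def p_space anc_p)

lemma rng_hom: "rng \<Gamma> (\<phi> w) = p (rng \<Delta> w)"
  by (simp add: Yg.semidirect_sel Xg.semidirect_sel semidirect_hom_def split_beta)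

lemma src_hom:
  assumes "w \<in> space (arr \<Delta>)"
  shows "src \<Gamma> (\<phi> w) = p (src \<Delta> w)"
proof -
  obtain y g where "w = (y, g)" "y \<in> space (pts Y)" "g \<in> space (arr G)" "anc Y y = rng G g"
    using assms by (auto simp: Yg.space_arr)
  then show ?thesis
    by (simp add: Yg.semidirect_sel(5) Xg.semidirect_sel(5) semidirect_hom_def act_p Yg.ivs_closed Yg.src_ivs)
qed

lemma mlt_hom: "mlt \<Gamma> (\<phi> w) (\<phi> w') = \<phi> (mlt \<Delta> w w')"
  by (simp add: Yg.semidirect_sel(6) Xg.semidirect_sel(6) semidirect_hom_def split_beta)

lemma hom_measurable: "\<phi> \<in> measurable (arr \<Delta>) (arr \<Gamma>)"
  unfolding Xg.semidirect_sel(1)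
proof (rule measurable_restrict_space2)
  show "\<phi> \<in> space (arr \<Delta>) \<rightarrow> {(x, g). anc X x = rng G g}"
    using hom_arrow by (fastforce simp: Xg.space_arr)
  have "(\<lambda>w. (p (fst w), snd w)) \<in> measurable (arr \<Delta>) (pts X \<Otimes>\<^sub>M arr G)"
    unfolding Yg.semidirect_sel(1) by (rule measurable_restrict_space1) measurable
  then show "\<phi> \<in> measurable (arr \<Delta>) (pts X \<Otimes>\<^sub>M arr G)"
    by (simp add: semidirect_hom_def split_beta)
qed

sublocale base: bundle_cocycles \<Gamma> B L
proof (unfold_locales, unfold Xg.semidirect_sel(2))
  show "hilbert_bundle (pts X) B" by (rule is_bundle)
  show "rng \<Gamma> \<in> measurable (arr \<Gamma>) (pts X)" by (rule Xg.rng_measurable)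
qed (use Xg.src_space L_iso in auto)

sublocale ext: bundle_cocycles \<Delta> B' "L \<circ> \<phi>"
proof (unfold_locales, unfold Yg.semidirect_sel(2))
  show "hilbert_bundle (pts Y) B'" by (rule hilbert_bundle_pullback[OF p_measurable])
  show "rng \<Delta> \<in> measurable (arr \<Delta>) (pts Y)" by (rule Yg.rng_measurable)
  show "hilbert_iso (fib B' (src \<Delta> w)) (fib B' (rng \<Delta> w)) ((L \<circ> \<phi>) w)" if "w \<in> space (arr \<Delta>)" for w
    using L_iso[OF hom_arrow[OF that]] by (simp add: fib_pullback rng_hom src_hom that)
qed (use Yg.src_space in auto)

text \<open>The preimage under \<open>p\<close> of a conull set of units is conull, and \<phi> maps
  the corresponding reductions into each other.\<close>

lemma cocycle_lift:
  assumes b: "b \<in> cocycles \<Gamma> B L"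
  shows "b \<circ> \<phi> \<in> cocycles \<Delta> B' (L \<circ> \<phi>)"
proof -
  obtain U where bs: "b \<in> sections (pullback (arr \<Gamma>) (rng \<Gamma>) B)" and U: "conull \<mu> U"
    and co: "holds_on_composable \<Gamma> U (\<lambda>g h. b (mlt \<Gamma> g h) = hadd (fib B (rng \<Gamma> g)) (b g) (L g (b h)))"
    using b by (auto simp: cocycles_def Xg.semidirect_sel(3))
  have "b \<circ> \<phi> \<in> sections (pullback (arr \<Delta>) (\<lambda>w. p (rng \<Delta> w)) B)"
    using pullback_comp[OF Xg.rng_measurable bs hom_measurable] by (simp add: rng_hom comp_def)
  then have s: "b \<circ> \<phi> \<in> sections (pullback (arr \<Delta>) (rng \<Delta>) B')"
    unfolding sections_pullback_pullback[OF p_measurable Yg.rng_measurable] .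
  define V where "V = p -` U \<inter> space (pts Y)"
  have "conull \<nu> V"
    unfolding conull_iff_AE
  proof
    show "V \<in> sets \<nu>"
      using U unfolding V_def Yg.sets_base conull_iff_AE Xg.sets_base
      by (intro measurable_sets[OF p_measurable]) blast
    have "AE y in \<nu>. p y \<in> U" using U by (intro AE_lift) (simp add: conull_iff_AE)
    with AE_space show "AE y in \<nu>. y \<in> V"
      by eventually_elim (simp add: V_def space_ext)
  qed
  moreover have "holds_on_composable \<Delta> V
      (\<lambda>g h. (b \<circ> \<phi>) (mlt \<Delta> g h) = hadd (fib B' (rng \<Delta> g)) ((b \<circ> \<phi>) g) ((L \<circ> \<phi>) g ((b \<circ> \<phi>) h)))"
    unfolding holds_on_composable_def
  proof (intro ballI impI)
    fix g h assume gh: "g \<in> reduction_arrows \<Delta> V" "h \<in> reduction_arrows \<Delta> V" "src \<Delta> g = rng \<Delta> h"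
    have lift: "\<phi> w \<in> reduction_arrows \<Gamma> U" if "w \<in> reduction_arrows \<Delta> V" for w
      using that by (auto simp: reduction_arrows_def hom_arrow rng_hom src_hom V_def)
    have "src \<Gamma> (\<phi> g) = rng \<Gamma> (\<phi> h)"
      using gh by (simp add: reduction_arrows_def src_hom rng_hom)
    then have "b (mlt \<Gamma> (\<phi> g) (\<phi> h)) = hadd (fib B (rng \<Gamma> (\<phi> g))) (b (\<phi> g)) (L (\<phi> g) (b (\<phi> h)))"
      using co lift[OF gh(1)] lift[OF gh(2)] unfolding holds_on_composable_def by blast
    then show "(b \<circ> \<phi>) (mlt \<Delta> g h) = hadd (fib B' (rng \<Delta> g)) ((b \<circ> \<phi>) g) ((L \<circ> \<phi>) g ((b \<circ> \<phi>) h))"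
      by (simp add: mlt_hom fib_pullback rng_hom)
  qed
  ultimately show ?thesis
    using s unfolding cocycles_def Yg.semidirect_sel(3) by blast
qed

text \<open>The section is composed with \<open>p\<close>. The exceptional set lifts because
  \<open>y\<close> and \<open>p y\<close> have the same anchor, hence the same Haar measure.\<close>

lemma coboundary_lift:
  assumes "coboundary \<Gamma> B L a"
  shows "coboundary \<Delta> B' (L \<circ> \<phi>) (a \<circ> \<phi>)"
proof -
  obtain \<xi> where \<xi>: "\<xi> \<in> sections B"
    and ae: "AE w in arr_meas \<Gamma>. a w = hdiff (fib B (rng \<Gamma> w)) (\<xi> (rng \<Gamma> w)) (L w (\<xi> (src \<Gamma> w)))"
    using assms by (auto simp: coboundary_def)
  obtain N where N: "N \<in> sets (pts X \<Otimes>\<^sub>M arr G)"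
      "AE x in \<mu>. AE g in haar G (anc X x). (x, g) \<notin> N"
      "\<And>w. w \<in> space (arr \<Gamma>) \<Longrightarrow> w \<notin> N \<Longrightarrow> a w = hdiff (fib B (rng \<Gamma> w)) (\<xi> (rng \<Gamma> w)) (L w (\<xi> (src \<Gamma> w)))"
    using Xg.AE_arr_measD[OF ae] by blast
  have "(\<lambda>w. (p (fst w), snd w)) \<in> measurable (pts Y \<Otimes>\<^sub>M arr G) (pts X \<Otimes>\<^sub>M arr G)" by measurable
  from measurable_sets[OF this N(1)]
  have N': "(\<lambda>w. (p (fst w), snd w)) -` N \<inter> space (pts Y \<Otimes>\<^sub>M arr G) \<in> sets (pts Y \<Otimes>\<^sub>M arr G)" (is "?N \<in> _") .
  have "AE y in \<nu>. AE g in haar G (anc X (p y)). (p y, g) \<notin> N" using N(2) by (rule AE_lift)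
  with AE_space have ae_N: "AE y in \<nu>. AE g in haar G (anc Y y). (y, g) \<notin> ?N"
  proof eventually_elim
    fix y assume "y \<in> space \<nu>" and ae_y: "AE g in haar G (anc X (p y)). (p y, g) \<notin> N"
    then have y: "y \<in> space (pts Y)" by (simp add: space_ext)
    have "AE g in haar G (anc Y y). (p y, g) \<notin> N" using ae_y unfolding anc_p[OF y] .
    then show "AE g in haar G (anc Y y). (y, g) \<notin> ?N" by (rule eventually_mono) simp
  qed
  have "AE w in arr_meas \<Delta>. (a \<circ> \<phi>) w
      = hdiff (fib B' (rng \<Delta> w)) (\<xi> (p (rng \<Delta> w))) ((L \<circ> \<phi>) w (\<xi> (p (src \<Delta> w))))"
  proof (rule Yg.AE_arr_measI[OF N' ae_N])
    fix w assume w: "w \<in> space (arr \<Delta>)" "w \<notin> ?N"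
    then have "\<phi> w \<notin> N"
      by (auto simp: Yg.space_arr space_pair_measure semidirect_hom_def)
    from N(3)[OF hom_arrow[OF w(1)] this] w(1)
    show "(a \<circ> \<phi>) w = hdiff (fib B' (rng \<Delta> w)) (\<xi> (p (rng \<Delta> w))) ((L \<circ> \<phi>) w (\<xi> (p (src \<Delta> w))))"
      by (simp add: rng_hom src_hom fib_pullback)
  qed
  then show ?thesis
    unfolding coboundary_def using section_comp[OF p_measurable \<xi>] by (rule bexI)
qed

text \<open>The action of \<open>g\<close> is only defined over \<open>src G g\<close>. Extending it
  by the identity gives a Borel self-map of \<open>Y\<close>, as
  \<open>core_mean_equivariant\<close> expects, and changes nothing for
  \<open>\<rho> x\<close>.\<close>

lemma translation:
  assumes g: "g \<in> space (arr G)" and x: "x \<in> space (pts X)" and gx: "src G g = anc X x"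
  defines "\<tau> \<equiv> \<lambda>y. if anc Y y = src G g then act Y g y else y"
  shows "\<tau> \<in> measurable (pts Y) (pts Y)" and "distr (\<rho> x) (pts Y) \<tau> = \<rho> (act X g x)"
proof -
  define F where "F = {y \<in> space (pts Y). anc Y y = src G g}"
  have F: "F \<in> sets (pts Y)"
    unfolding F_def using Yg.src_closed[OF g]
    by (intro standard_borel_diagonal[OF Yg.standard_obj Yg.anc_borel]) simp
  have act: "act Y g \<in> measurable (restrict_space (pts Y) F) (pts Y)"
  proof -
    have "(\<lambda>y. (g, y)) \<in> measurable (restrict_space (pts Y) F)
        (restrict_space (arr G \<Otimes>\<^sub>M pts Y) {(g, x). src G g = anc Y x})"
      using g by (intro measurable_restrict_space2 measurable_restrict_space1)
        (auto simp: space_restrict_space F_def)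
    from measurable_compose[OF this Yg.act_borel] show ?thesis by simp
  qed
  have \<tau>: "\<tau> y = (if y \<in> F then act Y g y else y)" if "y \<in> space (pts Y)" for y
    using that by (simp add: \<tau>_def F_def)
  have "(\<lambda>y. if y \<in> F then act Y g y else y) \<in> measurable (pts Y) (pts Y)"
    using F act by (subst measurable_If_restrict_space_iff) (auto simp: Int_def[symmetric] sets.Int_space_eq2 measurable_restrict_space1)
  then show m: "\<tau> \<in> measurable (pts Y) (pts Y)" using \<tau> by (simp cong: measurable_cong)
  have m': "\<tau> \<in> measurable (\<rho> x) (pts Y)"
    using m by (simp add: measurable_cong_sets[OF sets_fibre[OF x] refl])
  have Fx: "F \<in> sets (\<rho> x)" using F by (simp add: sets_fibre[OF x])
  have act': "act Y g \<in> measurable (restrict_space (\<rho> x) F) (pts Y)"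
    using act by (simp add: measurable_cong_sets[OF sets_restrict_space_cong[OF sets_fibre[OF x]] refl])
  have "distr (\<rho> x) (pts Y) \<tau> = distr (restrict_space (\<rho> x) F) (pts Y) (act Y g)"
  proof (rule measure_eqI)
    fix A assume "A \<in> sets (distr (\<rho> x) (pts Y) \<tau>)"
    then have A: "A \<in> sets (pts Y)" by simp
    have eq: "act Y g -` A \<inter> space (restrict_space (\<rho> x) F) = (\<tau> -` A \<inter> space (\<rho> x)) \<inter> F"
      by (auto simp: space_restrict_space \<tau> space_fibre[OF x])
    have "emeasure (distr (restrict_space (\<rho> x) F) (pts Y) (act Y g)) A
        = emeasure (\<rho> x) ((\<tau> -` A \<inter> space (\<rho> x)) \<inter> F)"
      unfolding emeasure_distr[OF act' A] eq using Fx by (intro emeasure_restrict_space) auto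
    \<comment> \<open>\<open>F\<close> contains the fibre of \<open>p\<close> over \<open>x\<close>,
      so it is conull for \<open>\<rho> x\<close>.\<close>
    also have "\<dots> = emeasure (\<rho> x) (\<tau> -` A \<inter> space (\<rho> x))"
    proof (rule emeasure_eq_AE)
      show "AE y in \<rho> x. y \<in> (\<tau> -` A \<inter> space (\<rho> x)) \<inter> F \<longleftrightarrow> y \<in> \<tau> -` A \<inter> space (\<rho> x)"
        using AE_fibre[OF x] AE_space
        by eventually_elim (auto simp: F_def space_fibre[OF x] gx anc_p)
    qed (use measurable_sets[OF m' A] Fx in auto)
    finally show "emeasure (distr (\<rho> x) (pts Y) \<tau>) A
        = emeasure (distr (restrict_space (\<rho> x) F) (pts Y) (act Y g)) A"
      by (simp add: emeasure_distr[OF m' A])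
  qed simp
  then show "distr (\<rho> x) (pts Y) \<tau> = \<rho> (act X g x)"
    using invariant[OF g x gx] by (simp add: F_def)
qed

text \<open>The heart of injectivity: the primitive on \<open>Y\<close> is replaced by the centres
  of its fibrewise distributions. For almost every arrow, the coboundary identity says that the
  affine isometry with translation part \<open>a w\<close> relates \<eta> to its translate, so the
  centres satisfy the same relation.\<close>

lemma coboundary_descends:
  assumes a: "\<And>w. w \<in> space (arr \<Gamma>) \<Longrightarrow> a w \<in> hcar (fib B (rng \<Gamma> w))"
    and cob: "coboundary \<Delta> B' (L \<circ> \<phi>) (a \<circ> \<phi>)"
  shows "coboundary \<Gamma> B L a"
proof -
  obtain \<eta> where \<eta>: "\<eta> \<in> sections B'"
    and ae: "AE w in arr_meas \<Delta>. (a \<circ> \<phi>) w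
      = hdiff (fib B' (rng \<Delta> w)) (\<eta> (rng \<Delta> w)) ((L \<circ> \<phi>) w (\<eta> (src \<Delta> w)))"
    using cob by (auto simp: coboundary_def)
  interpret S: fibred_section "pts Y" "pts X" p \<rho> B \<eta>
    by unfold_locales (rule \<eta>)
  obtain N where N: "N \<in> sets (pts Y \<Otimes>\<^sub>M arr G)"
      "AE y in \<nu>. AE g in haar G (anc Y y). (y, g) \<notin> N"
      "\<And>w. w \<in> space (arr \<Delta>) \<Longrightarrow> w \<notin> N \<Longrightarrow> (a \<circ> \<phi>) w
        = hdiff (fib B' (rng \<Delta> w)) (\<eta> (rng \<Delta> w)) ((L \<circ> \<phi>) w (\<eta> (src \<Delta> w)))"
    using Yg.AE_arr_measD[OF ae] by blast
  \<comment> \<open>The set depends on the arrow of \<open>G\<close> only; indexing it by the pair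
    \<open>w\<close> matches it with the measure \<open>\<rho> (fst w)\<close>.\<close>
  define A where "A = (\<lambda>w :: 'x \<times> 'g. {y \<in> space (pts Y). (y, snd w) \<in> N})"
  have A_rel: "(SIGMA w:space (pts X \<Otimes>\<^sub>M arr G). A w) \<in> sets ((pts X \<Otimes>\<^sub>M arr G) \<Otimes>\<^sub>M pts Y)"
  proof -
    have "(\<lambda>v. (snd v, snd (fst v))) \<in> measurable ((pts X \<Otimes>\<^sub>M arr G) \<Otimes>\<^sub>M pts Y) (pts Y \<Otimes>\<^sub>M arr G)"
      by measurable
    from measurable_sets[OF this N(1)]
    show ?thesis
      by (rule back_subst[of "\<lambda>S. S \<in> _"]) (auto simp: A_def space_pair_measure)
  qed
  \<comment> \<open>The pairs for which the identity fails on a non-null part of the fibre. Outside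
    this set, one fixed arrow acts correctly on almost all of the fibre.\<close>
  define N' where "N' = {w \<in> space (pts X \<Otimes>\<^sub>M arr G). emeasure (\<rho> (fst w)) (A w) \<noteq> 0}"
  have [measurable]: "(\<lambda>w. emeasure (\<rho> (fst w)) (A w)) \<in> borel_measurable (pts X \<Otimes>\<^sub>M arr G)"
    by (rule emeasure_measurable_subprob_algebra2[OF A_rel]) measurable
  have N'_sets: "N' \<in> sets (pts X \<Otimes>\<^sub>M arr G)" unfolding N'_def by measurable
  have A_iff: "emeasure (\<rho> x) (A (x, g)) = 0 \<longleftrightarrow> (AE y in \<rho> x. (y, g) \<notin> N)"
    if "x \<in> space (pts X)" "g \<in> space (arr G)" for x g
  proof -
    have s: "A (x, g) \<in> sets (\<rho> x)"
      using sets_Pair1[OF A_rel, of "(x, g)"] that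
      by (simp add: sets_fibre vimage_def space_pair_measure A_def)
    have "emeasure (\<rho> x) (A (x, g)) = 0 \<longleftrightarrow> (AE y in \<rho> x. y \<notin> A (x, g))"
      using AE_iff_null_sets[OF s] s by (simp add: null_sets_def)
    also have "\<dots> \<longleftrightarrow> (AE y in \<rho> x. (y, g) \<notin> N)"
      by (intro AE_cong) (simp add: A_def space_fibre that)
    finally show ?thesis .
  qed
  have "AE x in \<mu>. AE y in \<rho> x. AE g in haar G (anc Y y). (y, g) \<notin> N"
    using N(2) by (rule AE_disintegrate)
  with AE_space have ae_N': "AE x in \<mu>. AE g in haar G (anc X x). (x, g) \<notin> N'"
  proof eventually_elim
    fix x assume "x \<in> space \<mu>" and ax: "AE y in \<rho> x. AE g in haar G (anc Y y). (y, g) \<notin> N"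
    then have x: "x \<in> space (pts X)" by (simp add: space_base)
    note u = Xg.anc_space[OF x]
    have sets: "sets (\<rho> x \<Otimes>\<^sub>M Yg.haar_prob (anc X x)) = sets (pts Y \<Otimes>\<^sub>M arr G)"
      by (intro sets_pair_measure_cong sets_fibre Yg.sets_haar_prob x u)
    interpret P: prob_space "\<rho> x" using x by (rule fibre_prob)
    interpret Q: prob_space "Yg.haar_prob (anc X x)" using u by (rule Yg.prob_space_haar_prob)
    \<comment> \<open>The order of \<open>y\<close> and \<open>g\<close> is exchanged for the
      normalised Haar measure, which has the same null sets.\<close>
    interpret PQ: pair_sigma_finite "\<rho> x" "Yg.haar_prob (anc X x)" ..
    \<comment> \<open>Almost every \<open>y\<close> lies over \<open>x\<close> and so has the anchor
      of \<open>x\<close>; the measure in \<open>g\<close> thus no longer varies with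
      \<open>y\<close>, and the statement concerns a product measure.\<close>
    have "AE y in \<rho> x. AE g in Yg.haar_prob (anc X x). (y, g) \<notin> N"
      using ax AE_fibre[OF x] AE_space
    proof eventually_elim
      fix y assume y: "AE g in haar G (anc Y y). (y, g) \<notin> N" "p y = x" "y \<in> space (\<rho> x)"
      then have "anc Y y = anc X x" using anc_p[of y] by (simp add: space_fibre[OF x])
      with y(1) show "AE g in Yg.haar_prob (anc X x). (y, g) \<notin> N"
        unfolding Yg.AE_haar_prob[OF u] by (simp only:)
    qed
    moreover have "{w \<in> space (\<rho> x \<Otimes>\<^sub>M Yg.haar_prob (anc X x)). (fst w, snd w) \<notin> N}
        \<in> sets (\<rho> x \<Otimes>\<^sub>M Yg.haar_prob (anc X x))"
    proof -
      have "space (pts Y \<Otimes>\<^sub>M arr G) - N \<in> sets (pts Y \<Otimes>\<^sub>M arr G)" using N(1) by auto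
      moreover have "space (pts Y \<Otimes>\<^sub>M arr G) - N = {w \<in> space (pts Y \<Otimes>\<^sub>M arr G). (fst w, snd w) \<notin> N}"
        by auto
      ultimately show ?thesis unfolding sets sets_eq_imp_space_eq[OF sets] by simp
    qed
    ultimately have "AE g in Yg.haar_prob (anc X x). AE y in \<rho> x. (y, g) \<notin> N"
      using PQ.AE_commute[of "\<lambda>y g. (y, g) \<notin> N"] by simp
    then have "AE g in haar G (anc X x). AE y in \<rho> x. (y, g) \<notin> N"
      unfolding Yg.AE_haar_prob[OF u] .
    then show "AE g in haar G (anc X x). (x, g) \<notin> N'"
    proof (rule eventually_mono)
      fix g assume "AE y in \<rho> x. (y, g) \<notin> N"
      then show "(x, g) \<notin> N'" using A_iff[OF x] by (auto simp: N'_def space_pair_measure)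
    qed
  qed
  have "AE w in arr_meas \<Gamma>. a w = hdiff (fib B (rng \<Gamma> w)) (S.core_mean (rng \<Gamma> w)) (L w (S.core_mean (src \<Gamma> w)))"
  proof (rule Xg.AE_arr_measI[OF N'_sets ae_N'])
    fix w assume w: "w \<in> space (arr \<Gamma>)" "w \<notin> N'"
    obtain x g where xg: "w = (x, g)" and x: "x \<in> space (pts X)" and g: "g \<in> space (arr G)"
      and anc: "anc X x = rng G g"
      using w(1) by (auto simp: Xg.space_arr)
    define x' where "x' = act X (ivs G g) x"
    have sel: "rng \<Gamma> w = x" "src \<Gamma> w = x'"
      by (simp_all add: Xg.semidirect_sel(4,5) xg x'_def)
    have x': "x' \<in> space (pts X)" using Xg.src_space[OF w(1)] by (simp add: sel)
    interpret H: separable_hilbert_space "fib B x" using x by (rule fib_hilbert)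
    note i = Yg.ivs_closed[OF g] Yg.src_ivs[OF g]
    have sx: "src G (ivs G g) = anc X x" by (simp add: i anc)
    \<comment> \<open>The inverse acts, since the arrow \<open>(x, g)\<close> has range
      \<open>x\<close> and source \<open>x'\<close>, and the fibre over the range is to be carried
      to the fibre over the source.\<close>
    define \<tau> where "\<tau> = (\<lambda>y. if anc Y y = src G (ivs G g) then act Y (ivs G g) y else y)"
    have iso: "hilbert_iso (fib B x') (fib B x) (L w)" using L_iso[OF w(1)] by (simp add: sel)
    have ax: "a w \<in> hcar (fib B x)" using a[OF w(1)] by (simp add: sel)
    have "emeasure (\<rho> x) (A (x, g)) = 0" using w(2) x g by (simp add: N'_def xg space_pair_measure)
    then have "AE y in \<rho> x. (y, g) \<notin> N" using A_iff[OF x g] by blast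
    with AE_fibre[OF x] AE_space
    have "AE y in \<rho> x. \<eta> y = hadd (fib B x) (a w) (L w (\<eta> (\<tau> y)))"
    proof eventually_elim
      fix y assume py: "p y = x" and "y \<in> space (\<rho> x)" and nN: "(y, g) \<notin> N"
      then have y: "y \<in> space (pts Y)" by (simp add: space_fibre[OF x])
      have ancy: "anc Y y = rng G g" using anc_p[OF y] py anc by simp
      have yg: "(y, g) \<in> space (arr \<Delta>)" using y g ancy by (simp add: Yg.space_arr)
      have "a w = hdiff (fib B x) (\<eta> y) (L w (\<eta> (act Y (ivs G g) y)))"
        using N(3)[OF yg nN]
        by (simp add: semidirect_hom_def py xg fib_pullback Yg.semidirect_sel(4,5))
      moreover have "\<tau> y = act Y (ivs G g) y" by (simp add: \<tau>_def i ancy)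
      ultimately have eq: "a w = hdiff (fib B x) (\<eta> y) (L w (\<eta> (\<tau> y)))" by simp
      have "\<tau> y \<in> space (pts Y)" "p (\<tau> y) = x'"
        using \<open>\<tau> y = _\<close> Yg.act_closed[OF i(1) y] act_p[OF i(1) y] py by (simp_all add: i ancy x'_def)
      then have "\<eta> (\<tau> y) \<in> hcar (fib B x')" using S.closed_at[of "\<tau> y"] by simp
      then have c: "L w (\<eta> (\<tau> y)) \<in> hcar (fib B x)" by (rule hilbert_iso_closed[OF iso])
      have cy: "\<eta> y \<in> hcar (fib B x)" using S.closed_at[OF y] py by simp
      show "\<eta> y = hadd (fib B x) (a w) (L w (\<eta> (\<tau> y)))"
        unfolding eq by (rule H.inner_ext) (simp_all add: c cy H.closed H.inner_simps)
    qed
    from S.core_mean_equivariant[OF x x' iso ax _ _ this]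
    have cm: "S.core_mean x = hadd (fib B x) (a w) (L w (S.core_mean x'))"
      using translation[OF i(1) x sx] unfolding \<tau>_def x'_def by blast
    have c: "L w (S.core_mean x') \<in> hcar (fib B x)"
      by (rule hilbert_iso_closed[OF iso S.core_mean(1)[OF x']])
    show "a w = hdiff (fib B (rng \<Gamma> w)) (S.core_mean (rng \<Gamma> w)) (L w (S.core_mean (src \<Gamma> w)))"
      unfolding sel cm by (rule H.inner_ext) (simp_all add: c ax H.closed H.inner_simps)
  qed
  then show ?thesis
    unfolding coboundary_def using S.core_mean_section by (rule bexI)
qed

text \<open>From right to left this makes the induced map well defined on classes; from left to
  right it is injectivity. Both directions concern the difference of the two cocycles, which lifts
  to the difference of their lifts.\<close>

lemma cohomologous_lift_iff:
  assumes b: "b \<in> cocycles \<Gamma> B L" and c: "c \<in> cocycles \<Gamma> B L"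
  shows "(b \<circ> \<phi>, c \<circ> \<phi>) \<in> cohomologous \<Delta> B' (L \<circ> \<phi>) \<longleftrightarrow> (b, c) \<in> cohomologous \<Gamma> B L"
proof -
  let ?a = "\<lambda>w. hdiff (fib B (rng \<Gamma> w)) (b w) (c w)"
  have "(\<lambda>w. hdiff (fib B' (rng \<Delta> w)) ((b \<circ> \<phi>) w) ((c \<circ> \<phi>) w)) = ?a \<circ> \<phi>"
    by (simp add: fun_eq_iff fib_pullback rng_hom)
  moreover have "coboundary \<Delta> B' (L \<circ> \<phi>) (?a \<circ> \<phi>) \<longleftrightarrow> coboundary \<Gamma> B L ?a"
    using coboundary_lift coboundary_descends[of ?a]
      separable_hilbert_space.diff_closed[OF base.rng_hilbert base.cocycle_closed[OF b] base.cocycle_closed[OF c]]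
    by blast
  ultimately show ?thesis
    using b c cocycle_lift[OF b] cocycle_lift[OF c] by (simp add: cohomologous_def)
qed

text \<open>All members of a class have cohomologous lifts, so the union defining
  \<open>H1_map\<close> runs over copies of a single class.\<close>

lemma H1_map_class:
  assumes b: "b \<in> cocycles \<Gamma> B L"
  shows "H1_map \<Delta> B' (L \<circ> \<phi>) \<phi> (cohomologous \<Gamma> B L `` {b}) = cohomologous \<Delta> B' (L \<circ> \<phi>) `` {b \<circ> \<phi>}"
proof -
  have "cohomologous \<Delta> B' (L \<circ> \<phi>) `` {c \<circ> \<phi>} = cohomologous \<Delta> B' (L \<circ> \<phi>) `` {b \<circ> \<phi>}"
    if "(b, c) \<in> cohomologous \<Gamma> B L" for c
  proof -
    have c: "c \<in> cocycles \<Gamma> B L" using that by (simp add: cohomologous_def)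
    show ?thesis
      using equiv_class_eq[OF ext.equiv_cohomologous] that cohomologous_lift_iff[OF b c] by blast
  qed
  moreover have "b \<in> cohomologous \<Gamma> B L `` {b}"
    using base.equiv_cohomologous b by (rule equiv_class_self)
  ultimately show ?thesis unfolding H1_map_def by blast
qed

theorem inj_on_H1_map: "inj_on (H1_map \<Delta> B' (L \<circ> \<phi>) \<phi>) (H1 \<Gamma> B L)"
proof (rule inj_onI)
  fix C D assume "C \<in> H1 \<Gamma> B L" "D \<in> H1 \<Gamma> B L"
    and eq: "H1_map \<Delta> B' (L \<circ> \<phi>) \<phi> C = H1_map \<Delta> B' (L \<circ> \<phi>) \<phi> D"
  then obtain b c where C: "C = cohomologous \<Gamma> B L `` {b}" and b: "b \<in> cocycles \<Gamma> B L"
    and D: "D = cohomologous \<Gamma> B L `` {c}" and c: "c \<in> cocycles \<Gamma> B L"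
    by (auto simp: H1_def quotient_def)
  have "(b \<circ> \<phi>, c \<circ> \<phi>) \<in> cohomologous \<Delta> B' (L \<circ> \<phi>)"
    using eq_equiv_class[OF _ ext.equiv_cohomologous cocycle_lift[OF c], of "b \<circ> \<phi>"] eq
    unfolding C D H1_map_class[OF b] H1_map_class[OF c] by blast
  then show "C = D"
    using equiv_class_eq[OF base.equiv_cohomologous] cohomologous_lift_iff[OF b c] C D by blast
qed

lemma H1_map_image: "H1_map \<Delta> B' (L \<circ> \<phi>) \<phi> ` H1 \<Gamma> B L \<subseteq> H1 \<Delta> B' (L \<circ> \<phi>)"
  unfolding H1_def using H1_map_class cocycle_lift by (auto elim!: quotientE intro!: quotientI)

end

text \<open>The union in \<open>H1_map\<close> is a set for any input. The conclusion therefore also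
  certifies that lifts of cocycles are cocycles, that the map sends the class of \<open>b\<close> to
  the class of its lift, and that its values lie in the cohomology over \<open>Y\<close>.\<close>

theorem lemma5p12:
  fixes G :: "('g, 'u) haar_groupoid"
    and Y :: "('g, 'u, 'y) gspace" and \<nu> :: "'y measure"
    and X :: "('g, 'u, 'x) gspace" and \<mu> :: "'x measure"
    and p :: "'y \<Rightarrow> 'x"
    and B :: "('x, 'h) hbundle" and L :: "'x \<times> 'g \<Rightarrow> 'h \<Rightarrow> 'h"
  assumes "borel_haar_groupoid G"
    and "measured_pair G Y \<nu> X \<mu> p"
    and "ergodic_pair G Y \<nu> X \<mu>"
    and "measure_preserving_pair G Y \<nu> X \<mu> p"
    and "hilbert_bundle (pts X) B"
    and "groupoid_rep (semidirect G X \<mu>) B L"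
  shows "let \<Gamma> = semidirect G X \<mu>; \<Delta> = semidirect G Y \<nu>; \<phi> = semidirect_hom p;
             B' = pullback (pts Y) p B; L' = L \<circ> \<phi>; \<Phi> = H1_map \<Delta> B' L' \<phi>
         in (\<forall>b\<in>cocycles \<Gamma> B L.
               b \<circ> \<phi> \<in> cocycles \<Delta> B' L' \<and>
               \<Phi> (cohomologous \<Gamma> B L `` {b}) = cohomologous \<Delta> B' L' `` {b \<circ> \<phi>}) \<and>
            \<Phi> ` H1 \<Gamma> B L \<subseteq> H1 \<Delta> B' L' \<and>
            inj_on \<Phi> (H1 \<Gamma> B L)"
proof -
  obtain \<rho> where \<rho>: "borel_system (pts Y) (pts X) p \<rho>" "\<forall>x\<in>space (pts X). prob_space (\<rho> x)"
    "\<forall>g\<in>space (arr G). \<forall>x\<in>space (pts X). src G g = anc X x \<longrightarrow>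
       distr (restrict_space (\<rho> x) {y \<in> space (pts Y). anc Y y = src G g}) (pts Y) (act Y g) = \<rho> (act X g x)"
    "\<forall>A\<in>sets (pts Y). emeasure \<nu> A = (\<integral>\<^sup>+ x. emeasure (\<rho> x) A \<partial>\<mu>)"
    using assms(4) unfolding measure_preserving_pair_def by blast
  have pair: "gspace G Y" "gspace G X" "quasi_invariant (semidirect G Y \<nu>)"
    "quasi_invariant (semidirect G X \<mu>)" "equivariant G Y X p"
    using assms(2) unfolding measured_pair_def by blast+
  have standard: "standard_borel (pts X)"
    using pair(2) by (rule gspace.standard_pts)
  have sets: "sets \<nu> = sets (pts Y)" "sets \<mu> = sets (pts X)"
    using pair(3,4) by (simp_all add: quasi_invariant_def semidirect_def)
  interpret measure_preserving_extension G Y \<nu> X \<mu> p \<rho> B L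
  proof (intro measure_preserving_extension.intro haar_gspace.intro haar_gspace_axioms.intro prob_system.intro
      borel_hilbert_bundle.intro measure_preserving_extension_axioms.intro)
    show "prob_space (\<rho> x)" if "x \<in> space (pts X)" for x using \<rho>(2) that by (rule bspec)
    show "distr (restrict_space (\<rho> x) {y \<in> space (pts Y). anc Y y = src G g}) (pts Y) (act Y g) = \<rho> (act X g x)"
      if "g \<in> space (arr G)" "x \<in> space (pts X)" "src G g = anc X x" for g x
      using bspec[OF bspec[OF \<rho>(3) that(1)] that(2)] that(3) by (rule mp)
    show "emeasure \<nu> A = (\<integral>\<^sup>+ x. emeasure (\<rho> x) A \<partial>\<mu>)" if "A \<in> sets (pts Y)" for A
      using \<rho>(4) that by (rule bspec)
    show "hilbert_iso (fib B (src (semidirect G X \<mu>) w)) (fib B (rng (semidirect G X \<mu>) w)) (L w)"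
      if "w \<in> space (arr (semidirect G X \<mu>))" for w
      using conjunct1[OF assms(6)[unfolded groupoid_rep_def]] that by (rule bspec)
  qed (fact assms(1,5) pair(1,2,5) sets \<rho>(1) standard)+
  show ?thesis
    unfolding Let_def using cocycle_lift H1_map_class H1_map_image inj_on_H1_map by blast
qed

end
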